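(* Let $S$ be a set of $2n$ points in regular wheel configuration in the plane, where $n \geq 3$ is odd. Suppose $F_1, F_2, \ldots, F_k$ are $k$ edge-disjoint non-crossing perfect matchings on $S$ such that $G = \bigcup_{i=1}^k F_i$ is a triangle-free geometric graph, with $k = \lceil n/2 \rceil$. Then each non-crossing perfect matching $F_i$ has exactly two boundary edges if and only if all radial edges in $G$ are in consecutive order.
   Context: A set $S$ of $m$ points is in regular wheel configuration if $m-1$ of its points are regularly (equally) spaced on a circle $C$ and the remaining point $x$ is the center of $C$. Here $m = 2n$. A radial edge is an edge of the form $xv$ with $v$ on $C$. A boundary edge is an edge joining two cyclically consecutive points of $S$ on $C$. The radial edges of $G$ (there are $k$ of them, since each perfect matching on $S$ contains exactly one) are in consecutive order if the points of $S$ on $C$ can be labelled $v_0, v_1, \ldots, v_{2n-2}$ in cyclic order so that the radial edges of $G$ are exactly $xv_0, xv_1, \ldots, xv_{k-1}$. A geometric graph is a graph whose vertices are points in the plane, no three on a common line, and whose edges are straight-line segments joining vertices. Two edges cross if they have a common point that is interior to both of them. A perfect matching on $S$ is a set of segments with endpoints in $S$ such that each point of $S$ is an endpoint of exactly one of them; it is non-crossing if no two of its edges cross. Matchings are edge-disjoint if no two of them have an edge in common. A geometric graph is triangle-free if it contains no complete subgraph on three vertices. *)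

theory Defs
  imports "HOL-Analysis.Analysis"
begin

text \<open>
  The plane is \<^typ>\<open>complex\<close>. A straight-line edge is represented by the set of its two
  endpoints; its relative interior is the open segment between them.
\<close>

definition straight_edges :: "complex set \<Rightarrow> complex set set" where
  "straight_edges S = {{a, b} | a b. a \<in> S \<and> b \<in> S \<and> a \<noteq> b}"

definition geometric_graph :: "complex set \<Rightarrow> complex set set \<Rightarrow> bool" where
  "geometric_graph S E \<longleftrightarrow>
     finite S \<and> E \<subseteq> straight_edges S \<and>
     (\<forall>a\<in>S. \<forall>b\<in>S. \<forall>c\<in>S. a \<noteq> b \<and> b \<noteq> c \<and> a \<noteq> c \<longrightarrow> \<not> collinear {a, b, c})"

definition triangle_free :: "complex set set \<Rightarrow> bool" where
  "triangle_free E \<longleftrightarrow>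
     \<not> (\<exists>a b c. a \<noteq> b \<and> b \<noteq> c \<and> a \<noteq> c \<and> {a, b} \<in> E \<and> {b, c} \<in> E \<and> {a, c} \<in> E)"

definition crosses :: "complex set \<Rightarrow> complex set \<Rightarrow> bool" where
  "crosses e f \<longleftrightarrow>
     (\<exists>a b c d. e = {a, b} \<and> f = {c, d} \<and> open_segment a b \<inter> open_segment c d \<noteq> {})"

definition perfect_matching :: "complex set \<Rightarrow> complex set set \<Rightarrow> bool" where
  "perfect_matching S F \<longleftrightarrow> F \<subseteq> straight_edges S \<and> (\<forall>p\<in>S. \<exists>!e. e \<in> F \<and> p \<in> e)"

definition noncrossing :: "complex set set \<Rightarrow> bool" where
  "noncrossing F \<longleftrightarrow> (\<forall>e\<in>F. \<forall>f\<in>F. e \<noteq> f \<longrightarrow> \<not> crosses e f)"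

text \<open>
  \<open>wheel_labelling x S v\<close>: the points of \<open>S\<close> other than \<open>x\<close> are equally spaced on a circle with
  centre \<open>x\<close>, and \<open>v 0, v 1, \<dots>\<close> lists them in cyclic order. Any starting point is allowed, and
  the sign of the step \<open>\<theta>\<close> allows both orientations. Only the values of \<open>v\<close> at indices below
  \<open>card S - 1\<close> are relevant.
\<close>

definition wheel_labelling :: "complex \<Rightarrow> complex set \<Rightarrow> (nat \<Rightarrow> complex) \<Rightarrow> bool" where
  "wheel_labelling x S v \<longleftrightarrow>
     S - {x} = v ` {..<card S - 1} \<and>
     (\<exists>r \<phi> \<theta>. r > 0 \<and> \<bar>\<theta>\<bar> = 2 * pi / real (card S - 1) \<and>
        (\<forall>j<card S - 1. v j = x + rcis r (\<phi> + real j * \<theta>)))"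

definition regular_wheel :: "complex \<Rightarrow> complex set \<Rightarrow> bool" where
  "regular_wheel x S \<longleftrightarrow> finite S \<and> x \<in> S \<and> (\<exists>v. wheel_labelling x S v)"

definition radial_edge :: "complex \<Rightarrow> complex set \<Rightarrow> complex set \<Rightarrow> bool" where
  "radial_edge x S e \<longleftrightarrow> (\<exists>p \<in> S - {x}. e = {x, p})"

definition boundary_edge :: "complex \<Rightarrow> complex set \<Rightarrow> complex set \<Rightarrow> bool" where
  "boundary_edge x S e \<longleftrightarrow>
     (\<exists>v i. wheel_labelling x S v \<and> i < card S - 1 \<and> e = {v i, v (Suc i mod (card S - 1))})"

definition radial_edges_consecutive ::
  "complex \<Rightarrow> complex set \<Rightarrow> complex set set \<Rightarrow> nat \<Rightarrow> bool" where
  "radial_edges_consecutive x S E k \<longleftrightarrow>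
     (\<exists>v. wheel_labelling x S v \<and> {e \<in> E. radial_edge x S e} = {{x, v j} | j. j < k})"

end

theory Submission
  imports Defs
begin

text \<open>
  Write \<open>n = 2h + 1\<close>, so that the rim has \<open>4h + 1\<close> points \<open>w\<^sub>a\<close>, with indices modulo \<open>4h + 1\<close>, and
  \<open>k = h + 1\<close>. Take a non-crossing perfect matching with radial edge \<open>x w\<^sub>j\<close> and cut the rim at
  \<open>w\<^sub>j\<close>. What remains is a non-crossing matching of a path of \<open>4h\<close> points. No chord has \<open>w\<^sub>j\<close> on its
  shorter arc, and the points under a chord are matched among themselves, so all chords have odd
  length below \<open>2h\<close>. Boundary edges are the innermost chords. As one chord covers at most \<open>2h\<close>
  points, there are exactly two boundary edges if and only if the matching is nested, that is,
  consists of \<open>x w\<^sub>j\<close> and two stacks of parallel chords covering the \<open>2h\<close> points on either side of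
  \<open>w\<^sub>j\<close> (\<open>two_boundary_edges_iff_nested\<close>). The theorem thus says that all matchings are nested if
  and only if the set \<open>J\<close> of indices of radial edges is a circular interval.

  Suppose that all matchings are nested. The chords of a stack have a common index sum
  (\<open>2j + 2h + 1\<close> or \<open>2j - 2h - 1\<close>) and every odd length below \<open>2h\<close> occurs among them. So one can
  compute which triples of stacks contain the sides of a triangle on the rim, and being
  triangle-free turns into two forbidden patterns for triples in \<open>J\<close>. Edge-disjointness excludes
  the distances \<open>2h\<close> and \<open>2h + 1\<close>. Together with \<open>|J| = h + 1\<close> this forces an interval
  (\<open>nested_imp_radial_interval\<close>, resting on the purely combinatorial \<open>circular_interval\<close>).

  Suppose conversely that \<open>J = {0, ..., h}\<close>. These points are neighbours of \<open>x\<close>, hence pairwise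
  non-adjacent, and must be matched to points outside \<open>J\<close>. Going down from \<open>j = h\<close>, the matchings
  already treated have used up all chords of larger index sum to the left of \<open>w\<^sub>j\<close>, and the
  length bound excludes the smaller ones, so the left-hand chords are forced one after the other to
  form a stack (\<open>radial_interval_imp_nested_left\<close>). A reflection gives the right-hand stacks.
\<close>

section \<open>Non-crossing matchings of an integer interval\<close>

text \<open>
  Cutting the rim at the end of the radial edge leaves a path, so the chords of a matching of the
  wheel become an involution \<open>\<mu>\<close> of an integer interval, defined on all integers but relevant on
  \<open>{p..q}\<close> only.
\<close>

definition nc_matching :: "int \<Rightarrow> int \<Rightarrow> (int \<Rightarrow> int) \<Rightarrow> bool" where
  "nc_matching p q \<mu> \<longleftrightarrow>
     (\<forall>a\<in>{p..q}. \<mu> a \<in> {p..q} \<and> \<mu> a \<noteq> a \<and> \<mu> (\<mu> a) = a) \<and>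
     (\<forall>a\<in>{p..q}. \<forall>b\<in>{p..q}. \<not> (a < b \<and> b < \<mu> a \<and> \<mu> a < \<mu> b))"

lemma nc_matchingD:
  assumes "nc_matching p q \<mu>" "p \<le> a" "a \<le> q"
  shows "p \<le> \<mu> a" "\<mu> a \<le> q" "\<mu> a \<noteq> a" "\<mu> (\<mu> a) = a"
  using assms unfolding nc_matching_def by auto

lemma nc_matching_not_interleaved:
  assumes "nc_matching p q \<mu>" "p \<le> a" "a < b" "b < \<mu> a" "\<mu> a < \<mu> b" "b \<le> q"
  shows False
  using assms unfolding nc_matching_def by auto

lemma nc_matching_inside_chord:
  assumes nc: "nc_matching p q \<mu>" and a: "p \<le> a" "a \<le> q"
  shows "nc_matching (a + 1) (\<mu> a - 1) \<mu>"
proof -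
  have inside: "a < \<mu> c \<and> \<mu> c < \<mu> a" if c: "a < c" "c < \<mu> a" for c
  proof -
    note A = nc_matchingD[OF nc a]
    have cr: "p \<le> c" "c \<le> q" using A a c by linarith+
    note C = nc_matchingD[OF nc cr]
    have ne: "\<mu> c \<noteq> a" "\<mu> c \<noteq> \<mu> a" using A C c by auto
    have "\<not> \<mu> c > \<mu> a"
      using nc_matching_not_interleaved[OF nc, of a c] a c cr by auto
    moreover have "\<not> \<mu> c < a"
      using nc_matching_not_interleaved[OF nc, of "\<mu> c" a] a c C by auto
    ultimately show ?thesis using ne by linarith
  qed
  show ?thesis
    unfolding nc_matching_def
    using inside nc_matchingD[OF nc] nc_matching_not_interleaved[OF nc] a
      nc_matchingD[OF nc a]
    by (auto simp: add1_zle_eq zle_diff1_eq) (smt (verit))+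
qed

lemma nc_matching_after_first_chord:
  assumes nc: "nc_matching p q \<mu>" and "p \<le> q"
  shows "nc_matching (\<mu> p + 1) q \<mu>"
proof -
  have p: "p \<le> p" "p \<le> q" using assms by auto
  note P = nc_matchingD[OF nc p]
  have after: "\<mu> p < \<mu> c" if c: "\<mu> p < c" "c \<le> q" for c
  proof -
    have cr: "p \<le> c" "c \<le> q" using P c by linarith+
    note C = nc_matchingD[OF nc cr]
    have "\<mu> c \<noteq> p" "\<mu> c \<noteq> \<mu> p" using P C c by auto
    moreover have "\<not> (p < \<mu> c \<and> \<mu> c < \<mu> p)"
      using nc_matching_not_interleaved[OF nc, of p "\<mu> c"] c C by auto
    ultimately show ?thesis using C(1) by linarith
  qed
  show ?thesis
    unfolding nc_matching_def
    using after nc_matchingD[OF nc] nc_matching_not_interleaved[OF nc] P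
    by (auto simp: add1_zle_eq) (smt (verit))+
qed

lemma nc_matching_even:
  assumes "nc_matching p q \<mu>" "p \<le> q + 1"
  shows "even (q - p + 1)"
  using assms
proof (induction "nat (q - p + 1)" arbitrary: p q rule: less_induct)
  case less
  show ?case
  proof (cases "p \<le> q")
    case True
    note P = nc_matchingD[OF less.prems(1) order_refl True]
    have "p < \<mu> p" using P by linarith
    have "even (\<mu> p - 1 - (p + 1) + 1)"
      by (rule less.hyps) (use P \<open>p < \<mu> p\<close> nc_matching_inside_chord[OF less.prems(1), of p] True in auto)
    moreover have "even (q - (\<mu> p + 1) + 1)"
      by (rule less.hyps) (use P \<open>p < \<mu> p\<close> nc_matching_after_first_chord[OF less.prems(1)] True in auto)
    ultimately show ?thesis by presburger
  next
    case False
    then have "q = p - 1" using less.prems by linarith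
    then show ?thesis by simp
  qed
qed

lemma nc_matching_chord_odd:
  assumes nc: "nc_matching p q \<mu>" and a: "p \<le> a" "a \<le> q"
  shows "odd (\<mu> a - a)"
proof -
  note A = nc_matchingD[OF nc a]
  show ?thesis
  proof (cases "a < \<mu> a")
    case True
    have "even (\<mu> a - 1 - (a + 1) + 1)"
      by (rule nc_matching_even) (use nc_matching_inside_chord[OF nc a] True in auto)
    then show ?thesis by presburger
  next
    case False
    then have "\<mu> a < a" using A by linarith
    have "even (a - 1 - (\<mu> a + 1) + 1)"
      by (rule nc_matching_even[of _ _ \<mu>])
        (use nc_matching_inside_chord[OF nc, of "\<mu> a"] A \<open>\<mu> a < a\<close> in auto)
    then show ?thesis by presburger
  qed
qed

text \<open>An innermost chord joins two neighbours.\<close>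

lemma nc_matching_ex_short_chord:
  assumes "nc_matching p q \<mu>" "p \<le> q"
  shows "\<exists>a. p \<le> a \<and> a < q \<and> \<mu> a = a + 1"
  using assms
proof (induction "nat (q - p + 1)" arbitrary: p q rule: less_induct)
  case less
  note P = nc_matchingD[OF less.prems(1) order_refl less.prems(2)]
  show ?case
  proof (cases "\<mu> p = p + 1")
    case True
    then show ?thesis using P by (intro exI[of _ p]) auto
  next
    case False
    then have "\<exists>a. p + 1 \<le> a \<and> a < \<mu> p - 1 \<and> \<mu> a = a + 1"
      by (intro less.hyps) (use P nc_matching_inside_chord[OF less.prems(1), of p] less.prems(2) in auto)
    then obtain a where "p + 1 \<le> a" "a < \<mu> p - 1" "\<mu> a = a + 1" by blast
    then show ?thesis using P by (intro exI[of _ a]) linarith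
  qed
qed

text \<open>
  If the first chord did not reach the end of the interval, the part inside it and the part
  behind it would each have an innermost chord. So it does, and the same applies to what is
  left inside it.
\<close>

lemma nc_matching_unique_short_chord_nested:
  assumes "nc_matching p q \<mu>"
    and "\<And>a b. \<lbrakk>p \<le> a; a < q; \<mu> a = a + 1; p \<le> b; b < q; \<mu> b = b + 1\<rbrakk> \<Longrightarrow> a = b"
    and "p \<le> a" "a \<le> q"
  shows "\<mu> a = p + q - a"
  using assms
proof (induction "nat (q - p + 1)" arbitrary: p q a rule: less_induct)
  case less
  have pq: "p \<le> q" using less.prems by linarith
  note P = nc_matchingD[OF less.prems(1) order_refl pq]
  have "\<mu> p = q"
  proof (rule ccontr)
    assume "\<mu> p \<noteq> q"
    then have "\<mu> p < q" using P by linarith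
    obtain b where b: "\<mu> p + 1 \<le> b" "b < q" "\<mu> b = b + 1"
      using nc_matching_ex_short_chord[OF nc_matching_after_first_chord[OF less.prems(1) pq]]
        \<open>\<mu> p < q\<close> by auto
    obtain c where c: "p \<le> c" "c < \<mu> p" "\<mu> c = c + 1"
    proof (cases "\<mu> p = p + 1")
      case False
      then obtain c where "p + 1 \<le> c" "c < \<mu> p - 1" "\<mu> c = c + 1"
        using nc_matching_ex_short_chord[OF nc_matching_inside_chord[OF less.prems(1) order_refl pq]] P
        by auto
      then show ?thesis by (intro that[of c]) linarith+
    qed (use that P in auto)
    show False using less.prems(2)[of b c] b c P by linarith
  qed
  show ?case
  proof (cases "a = p \<or> a = q")
    case True
    moreover have "\<mu> q = p" using P(4) by (simp only: \<open>\<mu> p = q\<close>)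
    ultimately show ?thesis using \<open>\<mu> p = q\<close> by auto
  next
    case False
    have "\<mu> a = (p + 1) + (q - 1) - a"
    proof (rule less.hyps)
      show "nc_matching (p + 1) (q - 1) \<mu>"
        using nc_matching_inside_chord[OF less.prems(1) order_refl pq] \<open>\<mu> p = q\<close> by simp
      show "b = c" if "p + 1 \<le> b" "b < q - 1" "\<mu> b = b + 1" "p + 1 \<le> c" "c < q - 1" "\<mu> c = c + 1"
        for b c
        by (rule less.prems(2)) (use that in linarith)+
    qed (use False less.prems(3,4) in auto)
    then show ?thesis by simp
  qed
qed

text \<open>
  Chords of length at most \<open>2h\<close> (hence, by parity, below \<open>2h\<close>) cannot span \<open>4h\<close> points, so at
  least two chords are outermost. With only two innermost chords there are exactly two outermost
  ones, each covering \<open>2h\<close> points, and the chords under each are nested.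
\<close>

lemma nc_matching_two_short_chords:
  assumes nc: "nc_matching (j + 1) (j + 4 * h) \<mu>" and h: "h \<ge> 1"
    and len: "\<And>a. \<lbrakk>j + 1 \<le> a; a \<le> j + 4 * h\<rbrakk> \<Longrightarrow> \<bar>\<mu> a - a\<bar> \<le> 2 * h"
    and three: "\<And>a b c. \<lbrakk>j + 1 \<le> a; a < b; b < c; c < j + 4 * h;
                   \<mu> a = a + 1; \<mu> b = b + 1; \<mu> c = c + 1\<rbrakk> \<Longrightarrow> False"
  shows "\<And>a. \<lbrakk>j + 1 \<le> a; a \<le> j + 2 * h\<rbrakk> \<Longrightarrow> \<mu> a = 2 * j + 2 * h + 1 - a"
    and "\<And>a. \<lbrakk>j + 2 * h + 1 \<le> a; a \<le> j + 4 * h\<rbrakk> \<Longrightarrow> \<mu> a = 2 * j + 6 * h + 1 - a"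
proof -
  let ?p = "j + 1" and ?q = "j + 4 * h"
  have pq: "?p \<le> ?q" using h by linarith
  have shorter: "\<bar>\<mu> a - a\<bar> \<le> 2 * h - 1" if "?p \<le> a" "a \<le> ?q" for a
    using len[OF that] nc_matching_chord_odd[OF nc that] by presburger
  note P = nc_matchingD[OF nc order_refl pq]
  define r where "r = \<mu> ?p"
  have r: "?p < r" "r \<le> j + 2 * h" using P shorter[OF order_refl pq] unfolding r_def by linarith+
  have nc2: "nc_matching (r + 1) ?q \<mu>"
    using nc_matching_after_first_chord[OF nc pq] by (simp add: r_def)
  have rq: "r + 1 \<le> ?q" using r h by linarith
  note R = nc_matchingD[OF nc2 order_refl rq]
  define s where "s = \<mu> (r + 1)"
  have s: "r + 1 < s" "s \<le> ?q" "s - (r + 1) \<le> 2 * h - 1"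
    using R shorter[of "r + 1"] r rq unfolding s_def by linarith+
  have nc3: "nc_matching (s + 1) ?q \<mu>"
    using nc_matching_after_first_chord[OF nc2 rq] by (simp add: s_def)
  have short_under: "\<exists>c. a \<le> c \<and> c < \<mu> a \<and> \<mu> c = c + 1" if a: "?p \<le> a" "a < \<mu> a" "a \<le> ?q" for a
  proof (cases "\<mu> a = a + 1")
    case False
    then obtain c where "a + 1 \<le> c" "c < \<mu> a - 1" "\<mu> c = c + 1"
      using nc_matching_ex_short_chord[OF nc_matching_inside_chord[OF nc a(1,3)]] a by auto
    then show ?thesis by (intro exI[of _ c]) linarith
  qed (use a in auto)
  obtain c1 where c1: "?p \<le> c1" "c1 < r" "\<mu> c1 = c1 + 1"
    using short_under[of ?p] r pq unfolding r_def by auto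
  obtain c2 where c2: "r + 1 \<le> c2" "c2 < s" "\<mu> c2 = c2 + 1"
    using short_under[of "r + 1"] r rq s unfolding s_def by auto
  have sq: "s = ?q"
  proof (rule ccontr)
    assume "s \<noteq> ?q"
    then obtain c3 where "s + 1 \<le> c3" "c3 < ?q" "\<mu> c3 = c3 + 1"
      using nc_matching_ex_short_chord[OF nc3] s by auto
    then show False using three[of c1 c2 c3] c1 c2 by linarith
  qed
  have req: "r = j + 2 * h" using r s sq by linarith
  have ncA: "nc_matching ?p r \<mu>"
  proof -
    have "\<mu> a \<le> r" if "?p \<le> a" "a \<le> r" for a
    proof (cases "\<mu> a \<le> r")
      case False
      then have "r + 1 \<le> \<mu> a" "\<mu> a \<le> ?q" using nc_matchingD(2)[OF nc, of a] that rq by auto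
      then have "r + 1 \<le> \<mu> (\<mu> a)" using nc_matchingD(1)[OF nc2] by blast
      then show ?thesis using nc_matchingD(4)[OF nc, of a] that rq by auto
    qed
    then show ?thesis
      using nc rq unfolding nc_matching_def by auto
  qed
  show "\<mu> a = 2 * j + 2 * h + 1 - a" if a: "j + 1 \<le> a" "a \<le> j + 2 * h" for a
  proof -
    have "\<mu> a = ?p + r - a"
    proof (rule nc_matching_unique_short_chord_nested[OF ncA])
      show "b = c" if "?p \<le> b" "b < r" "\<mu> b = b + 1" "?p \<le> c" "c < r" "\<mu> c = c + 1" for b c
      proof (rule ccontr)
        assume "b \<noteq> c"
        have "c2 < j + 4 * h" "b < c2" "c < c2" using that c2 s by linarith+
        then show False
          using \<open>b \<noteq> c\<close> three[of b c c2] three[of c b c2] that c2(3) by force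
      qed
    qed (use a req in auto)
    then show ?thesis using req by simp
  qed
  show "\<mu> a = 2 * j + 6 * h + 1 - a" if a: "j + 2 * h + 1 \<le> a" "a \<le> j + 4 * h" for a
  proof -
    have "\<mu> a = (r + 1) + ?q - a"
    proof (rule nc_matching_unique_short_chord_nested[OF nc2])
      show "b = c" if "r + 1 \<le> b" "b < ?q" "\<mu> b = b + 1" "r + 1 \<le> c" "c < ?q" "\<mu> c = c + 1" for b c
      proof (rule ccontr)
        assume "b \<noteq> c"
        have "c1 < b" "c1 < c" using that c1 by linarith+
        then show False
          using \<open>b \<noteq> c\<close> three[of c1 b c] three[of c1 c b] that c1(1,3) by force
      qed
    qed (use a req in auto)
    then show ?thesis using req by simp
  qed
qed

section \<open>Circular sets without wide triples\<close>

text \<open>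
  Residues modulo \<open>4h + 1\<close> are handled through periodic sets of integers. Call two elements of
  \<open>J\<close> near if their circular distance is at most \<open>h\<close>. By \<open>no_split\<close> and \<open>antipode\<close> being near is
  transitive, and by \<open>no_wide\<close> there are at most two classes. With one class, \<open>J\<close> is \<open>h + 1\<close>
  points in a window of that many places. With two classes \<open>A\<close> (least element \<open>a\<close>) and \<open>B\<close>, the
  translate \<open>B'\<close> of \<open>B\<close> by \<open>- 2h\<close> avoids \<open>A\<close> and \<open>A + 1\<close>; this leaves at most \<open>h\<close> places for \<open>A\<close>
  and \<open>B'\<close> together.
\<close>

lemma circular_interval:
  fixes J :: "int set" and h :: int
  assumes h: "h \<ge> 1"
    and per: "\<And>a. a + (4 * h + 1) \<in> J \<longleftrightarrow> a \<in> J"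
    and card: "\<And>c. int (card (J \<inter> {c..c + 4 * h})) = h + 1"
    and antipode: "\<And>a. a \<in> J \<Longrightarrow> a + 2 * h \<notin> J" "\<And>a. a \<in> J \<Longrightarrow> a + 2 * h + 1 \<notin> J"
    and no_wide: "\<And>a b c. \<lbrakk>a \<in> J; b \<in> J; c \<in> J; b - a \<ge> h + 1; c - b \<ge> h + 1; c - a \<le> 3 * h\<rbrakk> \<Longrightarrow> False"
    and no_split: "\<And>a b c. \<lbrakk>a \<in> J; b \<in> J; c \<in> J; a < c; c < b; c - a \<le> h; b - c \<le> h;
                      b - a \<ge> h + 1; b - a \<le> 2 * h - 1\<rbrakk> \<Longrightarrow> False"
  shows "\<exists>c. J \<inter> {c..c + 4 * h} = {c..c + h}"
proof -
  have trans: "b - a \<le> h"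
    if "a \<in> J" "b \<in> J" "c \<in> J" "a < c" "c < b" "c - a \<le> h" "b - c \<le> h" for a b c
  proof -
    have "b \<noteq> a + 2 * h" using antipode(1)[of a] that by blast
    moreover have "\<not> (h + 1 \<le> b - a \<and> b - a \<le> 2 * h - 1)"
      using no_split[OF that] by blast
    ultimately show ?thesis using that by linarith
  qed
  have "J \<inter> {0..0 + 4 * h} \<noteq> {}" using card[of 0] h by force
  then obtain a0 where a0: "a0 \<in> J" by blast
  define a where "a = Min (J \<inter> {a0 - h..a0})"
  have fin: "finite (J \<inter> {a0 - h..a0})" by simp
  have "a \<in> J \<inter> {a0 - h..a0}" unfolding a_def using a0 h by (intro Min_in fin) auto
  then have a: "a \<in> J" "a0 - h \<le> a" "a \<le> a0" by auto
  have below: "b \<notin> J" if b: "a - h \<le> b" "b < a" for b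
  proof
    assume bJ: "b \<in> J"
    have "\<not> a0 - h \<le> b"
    proof
      assume "a0 - h \<le> b"
      then have "a \<le> b" unfolding a_def using bJ b a by (intro Min_le fin) auto
      then show False using b by simp
    qed
    then show False using trans[of b a0 a] bJ a a0 b by (cases "a = a0") auto
  qed
  define A where "A = J \<inter> {a..a + h}"
  define B where "B = J \<inter> {a + h + 1..a + 3 * h}"
  have AB: "J \<inter> {a..a + 4 * h} = A \<union> B"
  proof -
    have "b \<notin> J" if "a + 3 * h + 1 \<le> b" "b \<le> a + 4 * h" for b
      using below[of "b - (4 * h + 1)"] per[of "b - (4 * h + 1)"] that by auto
    then have "b \<le> a + 3 * h" if "b \<in> J" "b \<le> a + 4 * h" for b
      using that by (meson not_less zless_imp_add1_zle)
    then show ?thesis unfolding A_def B_def using h by force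
  qed
  have finAB: "finite A" "finite B" unfolding A_def B_def by auto
  have disj: "A \<inter> B = {}" unfolding A_def B_def by auto
  have cardAB: "int (card A) + int (card B) = h + 1"
    using card[of a] card_Un_disjoint[OF finAB disj] AB by simp
  have "B = {}"
  proof (rule ccontr)
    assume "B \<noteq> {}"
    define m where "m = Max A"
    have aA: "a \<in> A" using a h unfolding A_def by auto
    then have "m \<in> A" unfolding m_def using finAB by (intro Max_in) auto
    have Am: "c \<le> m" if "c \<in> A" for c unfolding m_def using that finAB by simp
    have m: "a \<le> m" "m \<le> a + h" "m \<in> J" using \<open>m \<in> A\<close> unfolding A_def by auto
    have Brange: "m + h + 1 \<le> b \<and> b \<le> a + 3 * h" if "b \<in> B" for b
    proof -
      have b: "b \<in> J" "a + h + 1 \<le> b" "b \<le> a + 3 * h" using that unfolding B_def by auto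
      have "\<not> b \<le> m + h"
        using trans[of a b m] a(1) m b by (cases "m = a") auto
      then show ?thesis using b by linarith
    qed
    define B' where "B' = (\<lambda>b. b - 2 * h) ` B"
    have cardB': "card B' = card B" unfolding B'_def by (rule card_image) (auto simp: inj_on_def)
    have finB': "finite B'" and "B' \<noteq> {}" using finAB \<open>B \<noteq> {}\<close> unfolding B'_def by auto
    have B'range: "m - h + 1 \<le> b \<and> b \<le> a + h" if "b \<in> B'" for b
      using that Brange unfolding B'_def by force
    have B'diam: "b - c \<le> h" if "b \<in> B'" "c \<in> B'" for b c
    proof -
      have "b + 2 * h \<in> B" "c + 2 * h \<in> B" using that unfolding B'_def by auto
      then have "\<not> h + 1 \<le> b - c"
        using no_wide[of a "c + 2 * h" "b + 2 * h"] a(1) unfolding B_def by auto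
      then show ?thesis by linarith
    qed
    have B'A: "b \<notin> A" "b - 1 \<notin> A" if "b \<in> B'" for b
    proof -
      have "b + 2 * h \<in> J" using that unfolding B'_def B_def by auto
      then show "b \<notin> A" "b - 1 \<notin> A"
        using antipode(1)[of b] antipode(2)[of "b - 1"] unfolding A_def by auto
    qed
    define p where "p = Min B'"
    define q where "q = Max B'"
    have pB: "p \<in> B'" and qB: "q \<in> B'" unfolding p_def q_def using finB' \<open>B' \<noteq> {}\<close> by auto
    have pq: "p \<le> b" "b \<le> q" if "b \<in> B'" for b unfolding p_def q_def using that finB' by auto
    have aAm: "a \<le> c \<and> c \<le> m" if "c \<in> A" for c using that Am unfolding A_def by auto
    have total: "int (card (A \<union> B')) = h + 1"
    proof -
      have "A \<inter> B' = {}" using B'A by blast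
      then show ?thesis using cardAB cardB' card_Un_disjoint[OF finAB(1) finB'] by simp
    qed
    \<comment> \<open>It remains to find a set of \<open>h\<close> integers that contains \<open>A \<union> B'\<close>: an interval of that
      length, or one longer by a single point that is in neither set.\<close>
    have bound: False if "A \<union> B' \<subseteq> I" "finite I" "int (card I) \<le> h" for I
      using card_mono[OF that(2,1)] that(3) total by linarith
    have hole: False
      if "A \<union> B' \<subseteq> {u..v}" "v - u \<le> h" "t \<notin> A" "t \<notin> B'" "u \<le> t" "t \<le> v" for u v t
    proof (rule bound)
      show "A \<union> B' \<subseteq> {u..v} - {t}" using that by auto
      show "int (card ({u..v} - {t})) \<le> h" using that by (simp add: card_Diff_singleton)
    qed simp
    have "p \<noteq> a" using B'A(1)[OF pB] aA by auto
    then consider "p < a" "q \<le> m" | "p < a" "q > m" | "p > a" by linarith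
    then show False
    proof cases
      case 1
      show False
      proof (rule bound)
        show "A \<union> B' \<subseteq> {p..m}" using pq aAm 1 by force
        show "int (card {p..m}) \<le> h" using B'range[OF pB] 1 m h by simp
      qed simp
    next
      case 2
      show False
      proof (rule hole[of p q "m + 1"])
        show "A \<union> B' \<subseteq> {p..q}" using pq aAm 2 by force
        show "q - p \<le> h" using B'diam[OF qB pB] .
        show "m + 1 \<notin> B'" using B'A(2)[of "m + 1"] \<open>m \<in> A\<close> by auto
        show "m + 1 \<notin> A" using Am[of "m + 1"] by auto
      qed (use 2 m in auto)
    next
      case 3
      show False
      proof (rule hole[of a "a + h" "p - 1"])
        show "A \<union> B' \<subseteq> {a..a + h}" using pq aAm 3 B'range m by force
        show "p - 1 \<notin> A" using B'A(2)[OF pB] .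
        show "p - 1 \<notin> B'" using pq(1)[of "p - 1"] by auto
      qed (use 3 B'range[OF pB] in auto)
    qed
  qed
  then have "int (card A) = h + 1" using cardAB by simp
  moreover have "A \<subseteq> {a..a + h}" unfolding A_def by auto
  moreover have "int (card {a..a + h}) = h + 1" using h by simp
  ultimately have "A = {a..a + h}" by (intro card_subset_eq) auto
  then show ?thesis using AB \<open>B = {}\<close> by auto
qed

section \<open>Crossings of chords and radii of a circle\<close>

text \<open>Twice the signed area of the triangle \<open>A B C\<close>.\<close>

definition signed_area :: "complex \<Rightarrow> complex \<Rightarrow> complex \<Rightarrow> real" where
  "signed_area A B C = Re (B - A) * Im (C - A) - Im (B - A) * Re (C - A)"

text \<open>
  The diagonals of a convex quadrilateral cross: the affine dependency
  \<open>[BCD] A + [ABD] C = [ACD] B + [ABC] D\<close> has positive weights with the same total on both sides,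
  so after normalisation it names a point of either diagonal.
\<close>

lemma convex_quadrilateral_diagonals_cross:
  assumes "signed_area A B C > 0" "signed_area A B D > 0"
    "signed_area A C D > 0" "signed_area B C D > 0"
  shows "crosses {A, C} {B, D}"
proof -
  define s where "s = signed_area B C D + signed_area A B D"
  have s: "s > 0" "s = signed_area A C D + signed_area A B C"
    using assms unfolding s_def by (auto simp: signed_area_def algebra_simps)
  define t where "t = signed_area A B D / s"
  define u where "u = signed_area A B C / s"
  define P where "P = (1 - t) *\<^sub>R A + t *\<^sub>R C"
  have t: "0 < t" "t < 1" using assms s(1) unfolding t_def s_def by auto
  have u: "0 < u" "u < 1" using assms s unfolding u_def by auto
  have scaled: "signed_area B C D *\<^sub>R A + signed_area A B D *\<^sub>R C
      = signed_area A C D *\<^sub>R B + signed_area A B C *\<^sub>R D"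
    by (simp add: complex_eq_iff signed_area_def algebra_simps)
  have weights: "s * t = signed_area A B D" "s * (1 - t) = signed_area B C D"
    "s * u = signed_area A B C" "s * (1 - u) = signed_area A C D"
    using s unfolding t_def u_def right_diff_distrib by (auto simp: s_def)
  have "s *\<^sub>R P = signed_area B C D *\<^sub>R A + signed_area A B D *\<^sub>R C"
    unfolding P_def scaleR_add_right scaleR_scaleR weights ..
  moreover have "s *\<^sub>R ((1 - u) *\<^sub>R B + u *\<^sub>R D) = signed_area A C D *\<^sub>R B + signed_area A B C *\<^sub>R D"
    unfolding scaleR_add_right scaleR_scaleR weights ..
  ultimately have "s *\<^sub>R P = s *\<^sub>R ((1 - u) *\<^sub>R B + u *\<^sub>R D)" using scaled by simp
  then have P2: "P = (1 - u) *\<^sub>R B + u *\<^sub>R D" using s(1) by simp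
  have "A \<noteq> C" "B \<noteq> D" using assms by (auto simp: signed_area_def)
  then have "P \<in> open_segment A C" "P \<in> open_segment B D"
    using t u P2 P_def unfolding in_segment by blast+
  then show ?thesis unfolding crosses_def by blast
qed

lemma signed_area_centre:
  "signed_area x (x + rcis r \<alpha>) (x + rcis r \<beta>) = r\<^sup>2 * sin (\<beta> - \<alpha>)"
  by (simp add: signed_area_def rcis_def sin_diff power2_eq_square algebra_simps)

lemma signed_area_circle:
  "signed_area (x + rcis r \<alpha>) (x + rcis r \<beta>) (x + rcis r \<gamma>)
     = 4 * r\<^sup>2 * (sin ((\<beta> - \<alpha>) / 2) * sin ((\<gamma> - \<beta>) / 2) * sin ((\<gamma> - \<alpha>) / 2))"
proof -
  define u v where "u = (\<beta> - \<alpha>) / 2" and "v = (\<gamma> - \<beta>) / 2"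
  have area: "signed_area (x + rcis r \<alpha>) (x + rcis r \<beta>) (x + rcis r \<gamma>)
      = r\<^sup>2 * (sin (\<beta> - \<alpha>) + sin (\<gamma> - \<beta>) - sin (\<gamma> - \<alpha>))"
    by (simp add: signed_area_def rcis_def sin_diff power2_eq_square algebra_simps)
  have angles: "\<beta> - \<alpha> = 2 * u" "\<gamma> - \<beta> = 2 * v" "\<gamma> - \<alpha> = 2 * u + 2 * v"
    and halves: "(\<beta> - \<alpha>) / 2 = u" "(\<gamma> - \<beta>) / 2 = v" "(\<gamma> - \<alpha>) / 2 = u + v"
    by (auto simp: u_def v_def field_simps)
  have "sin (2 * u) + sin (2 * v) - sin (2 * u + 2 * v) = 4 * (sin u * sin v * sin (u + v))"
  proof -
    have "sin (2 * u + 2 * v) = sin (2 * u) * cos (2 * v) + cos (2 * u) * sin (2 * v)"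
      by (rule sin_add)
    then show ?thesis
      unfolding cos_double_sin sin_double sin_add by (simp add: power2_eq_square algebra_simps)
  qed
  then show ?thesis
    unfolding area halves unfolding angles by simp
qed

lemma signed_area_circle_pos:
  assumes "r > 0" "\<alpha> < \<beta>" "\<beta> < \<gamma>" "\<gamma> < \<alpha> + 2 * pi"
  shows "signed_area (x + rcis r \<alpha>) (x + rcis r \<beta>) (x + rcis r \<gamma>) > 0"
  unfolding signed_area_circle using assms by (intro mult_pos_pos sin_gt_zero) auto

lemma chords_cross_circle:
  assumes "r > 0" "\<alpha> < \<beta>" "\<beta> < \<gamma>" "\<gamma> < \<delta>" "\<delta> < \<alpha> + 2 * pi"
  shows "crosses {x + rcis r \<alpha>, x + rcis r \<gamma>} {x + rcis r \<beta>, x + rcis r \<delta>}"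
  by (rule convex_quadrilateral_diagonals_cross; rule signed_area_circle_pos) (use assms in auto)

lemma radius_crosses_chord_circle:
  assumes "r > 0" "\<alpha> < \<beta>" "\<beta> < \<gamma>" "\<gamma> < \<alpha> + pi"
  shows "crosses {x, x + rcis r \<beta>} {x + rcis r \<alpha>, x + rcis r \<gamma>}"
proof (rule convex_quadrilateral_diagonals_cross)
  show "signed_area (x + rcis r \<alpha>) (x + rcis r \<beta>) (x + rcis r \<gamma>) > 0"
    by (rule signed_area_circle_pos) (use assms in auto)
qed (use assms in \<open>auto simp: signed_area_centre intro!: mult_pos_pos sin_gt_zero\<close>)

section \<open>The wheel as a periodic labelling\<close>

text \<open>
  The combinatorial content of a regular wheel with \<open>4h + 1\<close> rim points, listed in cyclic order
  by a periodic function on the integers. The crossing axioms are invariant under rotation and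
  reflection of \<open>w\<close>, which is used for all symmetry arguments below.
\<close>

locale cyclic_wheel =
  fixes x :: complex and S :: "complex set" and w :: "int \<Rightarrow> complex" and h :: int
  assumes h_pos: "h \<ge> 1"
    and w_eq_iff: "w a = w b \<longleftrightarrow> (4 * h + 1) dvd (a - b)"
    and w_neq_x: "w a \<noteq> x"
    and points: "S = insert x (range w)"
    and chords_cross: "\<lbrakk>a < b; b < c; c < d; d < a + 4 * h + 1\<rbrakk> \<Longrightarrow> crosses {w a, w c} {w b, w d}"
    and radius_crosses: "\<lbrakk>a < b; b < c; c \<le> a + 2 * h\<rbrakk> \<Longrightarrow> crosses {x, w b} {w a, w c}"

lemma crosses_commute: "crosses e f \<longleftrightarrow> crosses f e"
  unfolding crosses_def by blast

lemma range_affine_sign: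
  assumes "\<bar>s\<bar> = 1"
  shows "range (\<lambda>a. c + s * a) = (UNIV :: int set)"
proof -
  have "a = c + s * (s * (a - c))" for a
  proof -
    have "s * s = 1" using assms by (auto simp: abs_if split: if_splits)
    then show ?thesis by (simp flip: mult.assoc)
  qed
  then show ?thesis by (metis UNIV_eq_I rangeI)
qed

lemma cyclic_wheel_dihedral:
  assumes "cyclic_wheel x S w h" and s: "\<bar>s\<bar> = 1"
  shows "cyclic_wheel x S (\<lambda>a. w (c + s * a)) h"
proof -
  interpret cyclic_wheel x S w h by fact
  consider "s = 1" | "s = -1" using s by linarith
  then show ?thesis
  proof cases
    case 1
    then show ?thesis
      using h_pos w_neq_x points range_affine_sign[OF s, of c]
      by unfold_locales
        (auto simp: w_eq_iff intro: chords_cross radius_crosses simp flip: image_image)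
  next
    case 2
    have chords: "crosses {w (c - a), w (c - c')} {w (c - b), w (c - d)}"
      if "a < b" "b < c'" "c' < d" "d < a + 4 * h + 1" for a b c' d
      using chords_cross[of "c - d" "c - c'" "c - b" "c - a"] that
      by (simp add: crosses_commute insert_commute)
    have radius: "crosses {x, w (c - b)} {w (c - a), w (c - c')}"
      if "a < b" "b < c'" "c' \<le> a + 2 * h" for a b c'
      using radius_crosses[of "c - c'" "c - b" "c - a"] that by (simp add: insert_commute)
    show ?thesis
      using h_pos w_neq_x points range_affine_sign[OF s, of c] 2
      by unfold_locales
        (auto simp: w_eq_iff dvd_diff_commute intro: chords radius simp flip: image_image)
  qed
qed

context cyclic_wheel
begin

lemma w_shift [simp]: "w (a + (4 * h + 1)) = w a" "w (a - (4 * h + 1)) = w a"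
  using dvd_minus_iff[of "4 * h + 1" "4 * h + 1"] by (simp_all add: w_eq_iff)

lemma w_inj_window:
  assumes "w a = w b" "c \<le> a" "a \<le> c + 4 * h" "c \<le> b" "b \<le> c + 4 * h"
  shows "a = b"
  using assms zdvd_imp_le[of "4 * h + 1" "a - b"] zdvd_imp_le[of "4 * h + 1" "b - a"]
  by (simp add: w_eq_iff dvd_diff_commute) (smt (verit) dvd_diff_commute)

lemma w_window:
  obtains b where "c \<le> b" "b \<le> c + 4 * h" "w b = w a"
proof
  let ?b = "c + (a - c) mod (4 * h + 1)"
  show "c \<le> ?b" "?b \<le> c + 4 * h"
    using h_pos pos_mod_bound[of "4 * h + 1" "a - c"] by auto
  show "w ?b = w a" unfolding w_eq_iff
    by (metis add.commute dvd_minus_mod minus_diff_eq dvd_minus_iff diff_diff_eq2)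
qed

end

text \<open>
  Two labellings of the same wheel have the same radius, and each label of one is a label of the
  other; as the steps agree up to sign, they differ by a rotation or a reflection.
\<close>

lemma regular_wheel_obtain_labelling:
  assumes wheel: "regular_wheel x S" and card: "int (card S) = 4 * h + 2" and h: "h \<ge> 1"
  obtains w where "cyclic_wheel x S w h"
    and "\<And>v. wheel_labelling x S v \<longleftrightarrow>
           (\<exists>c s. \<bar>s\<bar> = 1 \<and> (\<forall>j<card S - 1. v j = w (c + s * int j)))"
proof -
  define N where "N = card S - 1"
  have N: "int N = 4 * h + 1" using card h unfolding N_def by linarith
  then have Npos: "N > 0" using h by linarith
  define \<theta> where "\<theta> = 2 * pi / real N"
  have \<theta>: "\<theta> > 0" "real N * \<theta> = 2 * pi" using Npos unfolding \<theta>_def by auto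
  obtain v0 r \<phi> \<theta>0 where v0: "S - {x} = v0 ` {..<N}" "r > 0" "\<bar>\<theta>0\<bar> = \<theta>"
      "\<And>j. j < N \<Longrightarrow> v0 j = x + rcis r (\<phi> + real j * \<theta>0)"
    using wheel unfolding regular_wheel_def wheel_labelling_def N_def \<theta>_def by auto
  have x: "x \<in> S" using wheel unfolding regular_wheel_def by auto
  define w where "w a = x + rcis r (\<phi> + of_int a * \<theta>)" for a :: int
  have rcis_eq: "rcis r \<alpha> = rcis r \<beta> \<longleftrightarrow> (\<exists>n::int. \<alpha> = \<beta> + 2 * pi * n)" for \<alpha> \<beta>
    using v0(2) sin_cos_eq_iff[of \<alpha> \<beta>] by (auto simp: rcis_def complex_eq_iff)
  have w_eq: "w a = w b \<longleftrightarrow> int N dvd (a - b)" for a b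
  proof -
    have "w a = w b \<longleftrightarrow> (\<exists>n::int. \<phi> + of_int a * \<theta> = \<phi> + of_int b * \<theta> + (real N * \<theta>) * n)"
      unfolding w_def by (simp add: rcis_eq \<theta>(2))
    also have "\<dots> \<longleftrightarrow> (\<exists>n::int. \<theta> * of_int (a - b) = \<theta> * of_int (int N * n))"
      by (simp add: algebra_simps)
    also have "\<dots> \<longleftrightarrow> (\<exists>n::int. a - b = int N * n)"
      using \<theta>(1) by (metis mult_cancel_left of_int_eq_iff less_irrefl)
    finally show ?thesis unfolding dvd_def .
  qed
  have image_window: "(\<lambda>j. w (c + s * int j)) ` {..<N} = range w" if s: "\<bar>s\<bar> = 1" for c s
  proof -
    have "w (c + s * a) \<in> (\<lambda>j. w (c + s * int j)) ` {..<N}" for a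
    proof (rule image_eqI)
      show "nat (a mod int N) \<in> {..<N}" using Npos by (simp add: nat_less_iff)
      have "s * (a - a mod int N) = (c + s * a) - (c + s * int (nat (a mod int N)))"
        using Npos by (simp add: algebra_simps)
      then show "w (c + s * a) = w (c + s * int (nat (a mod int N)))"
        unfolding w_eq by (metis dvd_minus_mod dvd_mult)
    qed
    then show ?thesis
      using range_affine_sign[OF s, of c] by (auto simp: image_iff) (metis UNIV_I rangeE)
  qed
  obtain s0 where s0: "\<bar>s0\<bar> = 1" "\<theta>0 = of_int s0 * \<theta>"
  proof (cases "\<theta>0 \<ge> 0")
    case True
    then show ?thesis using that[of 1] v0(3) by auto
  next
    case False
    then show ?thesis using that[of "-1"] v0(3) by auto
  qed
  have "S - {x} = (\<lambda>j. w (0 + s0 * int j)) ` {..<N}"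
    unfolding v0(1) by (rule image_cong) (auto simp: v0(4) w_def s0(2) ac_simps)
  then have range: "S - {x} = range w" using image_window[OF s0(1), of 0] by simp
  show ?thesis
  proof (rule that)
    have w_neq: "w a \<noteq> x" for a using range by auto
    have angle: "of_int b * \<theta> < of_int a * \<theta> + 2 * pi" if "b < a + int N" for a b
    proof -
      have "of_int b * \<theta> < (of_int a + real N) * \<theta>"
        using that \<theta>(1) by (intro mult_strict_right_mono) linarith+
      then show ?thesis using \<theta>(2) by (simp add: distrib_right)
    qed
    have half_angle: "of_int b * \<theta> < of_int a * \<theta> + pi" if "b \<le> a + 2 * h" for a b
    proof -
      have "of_int b * \<theta> < (of_int a + real N / 2) * \<theta>"
        using that \<theta>(1) N by (intro mult_strict_right_mono) linarith+
      then show ?thesis using \<theta>(2) by (simp add: distrib_right)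
    qed
    show "cyclic_wheel x S w h"
    proof
      show "w a = w b \<longleftrightarrow> (4 * h + 1) dvd (a - b)" for a b using w_eq N by simp
      show "S = insert x (range w)" using range x by auto
      show "crosses {w a, w c} {w b, w d}" if "a < b" "b < c" "c < d" "d < a + 4 * h + 1" for a b c d
        unfolding w_def
        by (rule chords_cross_circle) (use that v0(2) \<theta>(1) angle[of d a] N in auto)
      show "crosses {x, w b} {w a, w c}" if "a < b" "b < c" "c \<le> a + 2 * h" for a b c
        unfolding w_def
        by (rule radius_crosses_chord_circle) (use that v0(2) \<theta>(1) half_angle[of c a] in auto)
    qed (use h w_neq in auto)
    show "wheel_labelling x S v \<longleftrightarrow>
        (\<exists>c s. \<bar>s\<bar> = 1 \<and> (\<forall>j<card S - 1. v j = w (c + s * int j)))" for v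
    proof
      assume "\<exists>c s. \<bar>s\<bar> = 1 \<and> (\<forall>j<card S - 1. v j = w (c + s * int j))"
      then obtain c s where s: "\<bar>s\<bar> = 1" and v: "\<And>j. j < N \<Longrightarrow> v j = w (c + s * int j)"
        unfolding N_def by auto
      have "S - {x} = v ` {..<N}"
        unfolding range image_window[OF s, of c, symmetric] by (rule image_cong) (auto simp: v)
      moreover have "\<forall>j<N. v j = x + rcis r ((\<phi> + of_int c * \<theta>) + real j * (of_int s * \<theta>))"
        by (simp add: v w_def algebra_simps)
      moreover have "\<bar>of_int s * \<theta>\<bar> = 2 * pi / real N"
        using s \<theta>(1) unfolding \<theta>_def[symmetric] by (auto simp: abs_mult simp flip: of_int_abs)
      ultimately show "wheel_labelling x S v"
        unfolding wheel_labelling_def N_def[symmetric] using v0(2) by blast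
    next
      assume "wheel_labelling x S v"
      then obtain r' \<phi>' \<theta>' where v: "S - {x} = v ` {..<N}" "r' > 0" "\<bar>\<theta>'\<bar> = \<theta>"
          "\<And>j. j < N \<Longrightarrow> v j = x + rcis r' (\<phi>' + real j * \<theta>')"
        unfolding wheel_labelling_def N_def[symmetric] \<theta>_def by blast
      have "v 0 \<in> range w" using v(1) Npos unfolding range[symmetric] by auto
      then obtain c where "v 0 = w c" by auto
      then have c: "rcis r' \<phi>' = rcis r (\<phi> + of_int c * \<theta>)"
        using v(4)[OF Npos] by (simp add: w_def)
      then have "r' = r"
        using v(2) v0(2) by (metis abs_of_pos complex_mod_rcis)
      obtain s where s: "\<bar>s\<bar> = 1" "\<theta>' = of_int s * \<theta>"
      proof (cases "\<theta>' \<ge> 0")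
        case True
        then show ?thesis using that[of 1] v(3) by auto
      next
        case False
        then show ?thesis using that[of "-1"] v(3) by auto
      qed
      obtain n :: int where "\<phi>' = \<phi> + of_int c * \<theta> + 2 * pi * n"
        using c \<open>r' = r\<close> rcis_eq by auto
      then have "v j = w (c + s * int j)" if "j < N" for j
        unfolding v(4)[OF that] w_def \<open>r' = r\<close> s(2)
        by (auto simp: rcis_eq algebra_simps)
      then show "\<exists>c s. \<bar>s\<bar> = 1 \<and> (\<forall>j<card S - 1. v j = w (c + s * int j))"
        using s(1) unfolding N_def by blast
    qed
  qed
qed

section \<open>One non-crossing perfect matching of the wheel\<close>

locale wheel_matching = cyclic_wheel +
  fixes F :: "complex set set"
  assumes perfect: "perfect_matching S F" and nc: "noncrossing F"
begin

lemma w_in_S: "w a \<in> S" and x_in_S: "x \<in> S"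
  using points by auto

lemma edge_distinct: "{p, q} \<in> F \<Longrightarrow> p \<noteq> q"
  using perfect unfolding perfect_matching_def straight_edges_def
  by (auto simp: doubleton_eq_iff)

lemma partner_unique: "\<lbrakk>{p, q} \<in> F; {p, q'} \<in> F; p \<in> S\<rbrakk> \<Longrightarrow> q = q'"
  using perfect unfolding perfect_matching_def
  by (metis doubleton_eq_iff insertI1)

lemma partner_exists:
  assumes "p \<in> S"
  obtains q where "{p, q} \<in> F" "q \<in> S" "q \<noteq> p"
proof -
  obtain e where e: "e \<in> F" "p \<in> e" using perfect assms unfolding perfect_matching_def by blast
  then obtain a b where "a \<in> S" "b \<in> S" "a \<noteq> b" "e = {a, b}"
    using perfect unfolding perfect_matching_def straight_edges_def by blast
  then show ?thesis using e that[of a] that[of b] by (auto simp: insert_commute)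
qed

lemma radial_edge_exists:
  obtains j where "{x, w j} \<in> F"
  using partner_exists[OF x_in_S] points by (metis insertE rangeE)

lemma radial_edge_unique:
  assumes "{x, w a} \<in> F" "{x, w b} \<in> F" "c \<le> a" "a \<le> c + 4 * h" "c \<le> b" "b \<le> c + 4 * h"
  shows "a = b"
  using partner_unique[OF assms(1,2) x_in_S] w_inj_window assms(3-) by blast

lemma no_crossing: "\<lbrakk>e \<in> F; f \<in> F; crosses e f\<rbrakk> \<Longrightarrow> e = f"
  using nc unfolding noncrossing_def by blast

text \<open>
  Cutting the circle at the rim end \<open>w j\<close> of the radial edge. A chord joining two indices of the
  window that differ by more than \<open>2h\<close> would have \<open>w j\<close> on its shorter arc and cross the
  radial edge.
\<close>

lemma linear_matching:
  assumes radial: "{x, w j} \<in> F"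
  obtains \<mu> where "nc_matching (j + 1) (j + 4 * h) \<mu>"
    and "\<And>a. \<lbrakk>j + 1 \<le> a; a \<le> j + 4 * h\<rbrakk> \<Longrightarrow> {w a, w (\<mu> a)} \<in> F"
    and "\<And>a. \<lbrakk>j + 1 \<le> a; a \<le> j + 4 * h\<rbrakk> \<Longrightarrow> \<bar>\<mu> a - a\<bar> \<le> 2 * h"
proof -
  have ex: "\<exists>b. j + 1 \<le> b \<and> b \<le> j + 4 * h \<and> {w a, w b} \<in> F" if a: "j + 1 \<le> a" "a \<le> j + 4 * h" for a
  proof -
    obtain q where q: "{w a, q} \<in> F" "q \<in> S" using partner_exists[OF w_in_S] by blast
    have "q \<noteq> x"
    proof
      assume "q = x"
      then have "w a = w j"
        using q partner_unique[OF radial, of "w a"] x_in_S by (simp add: insert_commute)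
      then show False using w_inj_window[of a j j] a h_pos by auto
    qed
    then obtain b' where "q = w b'" using q points by auto
    then obtain b where b: "j \<le> b" "b \<le> j + 4 * h" "q = w b" using w_window by metis
    have "b \<noteq> j"
    proof
      assume "b = j"
      then have "w a = x"
        using q b partner_unique[of "w j" x "w a"] radial w_in_S by (simp add: insert_commute)
      then show False using w_neq_x by simp
    qed
    then show ?thesis using b q by (intro exI[of _ b]) auto
  qed
  define \<mu> where "\<mu> a = (SOME b. j + 1 \<le> b \<and> b \<le> j + 4 * h \<and> {w a, w b} \<in> F)" for a
  have \<mu>: "j + 1 \<le> \<mu> a" "\<mu> a \<le> j + 4 * h" "{w a, w (\<mu> a)} \<in> F" if "j + 1 \<le> a" "a \<le> j + 4 * h" for a
    using someI_ex[OF ex[OF that]] unfolding \<mu>_def by auto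
  have inj: "a = b" if "w a = w b" "j + 1 \<le> a" "a \<le> j + 4 * h" "j + 1 \<le> b" "b \<le> j + 4 * h" for a b
    using w_inj_window[of a b j] that by auto
  have invol: "\<mu> (\<mu> a) = a" if a: "j + 1 \<le> a" "a \<le> j + 4 * h" for a
  proof (rule inj)
    show "w (\<mu> (\<mu> a)) = w a"
      using \<mu>(3)[OF a] \<mu>(3)[OF \<mu>(1,2)[OF a]] partner_unique[OF _ _ w_in_S]
      by (metis insert_commute)
  qed (use \<mu> a in auto)
  have neq: "\<mu> a \<noteq> a" if "j + 1 \<le> a" "a \<le> j + 4 * h" for a
    using edge_distinct \<mu>(3)[OF that] by metis
  have short: "b - a \<le> 2 * h" if ab: "j + 1 \<le> a" "a < b" "b \<le> j + 4 * h" "{w a, w b} \<in> F" for a b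
  proof (rule ccontr)
    assume "\<not> b - a \<le> 2 * h"
    then have "crosses {x, w (j + (4 * h + 1))} {w b, w (a + (4 * h + 1))}"
      using ab by (intro radius_crosses) auto
    then have "crosses {x, w j} {w a, w b}" by (simp add: insert_commute)
    then have "{x, w j} = {w a, w b}" using no_crossing radial ab by blast
    then show False using w_neq_x by (auto simp: doubleton_eq_iff)
  qed
  show ?thesis
  proof (rule that)
    have "\<not> (a < b \<and> b < \<mu> a \<and> \<mu> a < \<mu> b)"
      if ab: "j + 1 \<le> a" "a \<le> j + 4 * h" "j + 1 \<le> b" "b \<le> j + 4 * h" for a b
    proof
      assume o: "a < b \<and> b < \<mu> a \<and> \<mu> a < \<mu> b"
      then have "crosses {w a, w (\<mu> a)} {w b, w (\<mu> b)}"
        using \<mu>(2)[OF ab(3,4)] ab(1) by (intro chords_cross) auto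
      then have "{w a, w (\<mu> a)} = {w b, w (\<mu> b)}"
        using no_crossing \<mu>(3) ab by blast
      then have "w a = w b \<or> w a = w (\<mu> b)" by (auto simp: doubleton_eq_iff)
      then show False using inj \<mu>[OF ab(3,4)] ab o by force
    qed
    then show "nc_matching (j + 1) (j + 4 * h) \<mu>"
      unfolding nc_matching_def using \<mu> neq invol by auto
    show "\<bar>\<mu> a - a\<bar> \<le> 2 * h" if "j + 1 \<le> a" "a \<le> j + 4 * h" for a
    proof (cases "a < \<mu> a")
      case True
      then show ?thesis using short[of a "\<mu> a"] \<mu>[OF that] that by auto
    next
      case False
      then have "\<mu> a < a" using neq[OF that] by linarith
      then show ?thesis using short[of "\<mu> a" a] \<mu>[OF that] that by (auto simp: insert_commute)
    qed
  qed (use \<mu> in auto)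
qed

text \<open>
  A stack of parallel chords: the \<open>2h\<close> points next to \<open>w\<^sub>j\<close> on one side are matched in
  mirror-image order. Each chord is listed for both of its ends.
\<close>

definition nested_left :: "int \<Rightarrow> bool" where
  "nested_left j \<longleftrightarrow> (\<forall>u\<in>{1..2 * h}. {w (j - u), w (j - (2 * h + 1 - u))} \<in> F)"

definition nested_right :: "int \<Rightarrow> bool" where
  "nested_right j \<longleftrightarrow> (\<forall>u\<in>{1..2 * h}. {w (j + u), w (j + (2 * h + 1 - u))} \<in> F)"

text \<open>
  Both stacks contribute one edge between neighbours. Conversely, two such edges force two
  stacks, because a chord never has the point \<open>w\<^sub>j\<close> on its shorter arc.
\<close>

lemma two_boundary_edges_iff_nested:
  assumes radial: "{x, w j} \<in> F"
  shows "card {e \<in> F. \<exists>i. e = {w i, w (i + 1)}} = 2 \<longleftrightarrow> nested_left j \<and> nested_right j"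
proof -
  obtain \<mu> where nc\<mu>: "nc_matching (j + 1) (j + 4 * h) \<mu>"
    and edge: "\<And>a. \<lbrakk>j + 1 \<le> a; a \<le> j + 4 * h\<rbrakk> \<Longrightarrow> {w a, w (\<mu> a)} \<in> F"
    and len: "\<And>a. \<lbrakk>j + 1 \<le> a; a \<le> j + 4 * h\<rbrakk> \<Longrightarrow> \<bar>\<mu> a - a\<bar> \<le> 2 * h"
    using linear_matching[OF radial] by blast
  note M = nc_matchingD[OF nc\<mu>]
  have inj: "a = b" if "w a = w b" "j \<le> a" "a \<le> j + 4 * h" "j \<le> b" "b \<le> j + 4 * h" for a b
    using w_inj_window[of a b j] that by auto
  have mate: "\<mu> a = b"
    if "{w a, w b} \<in> F" "j + 1 \<le> a" "a \<le> j + 4 * h" "j + 1 \<le> b" "b \<le> j + 4 * h" for a b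
  proof (rule inj)
    show "w (\<mu> a) = w b" by (rule partner_unique[OF edge that(1) w_in_S]) (use that in auto)
  qed (use that M(1,2)[OF that(2,3)] in auto)
  have rim_mate: False if "{w j, w b} \<in> F" for b
    using partner_unique[of "w j" x "w b"] radial that w_in_S w_neq_x by (metis insert_commute)
  define short where "short = {a. j + 1 \<le> a \<and> a < j + 4 * h \<and> \<mu> a = a + 1}"
  have bij: "bij_betw (\<lambda>a. {w a, w (a + 1)}) short {e \<in> F. \<exists>i. e = {w i, w (i + 1)}}"
  proof (rule bij_betw_imageI)
    show "inj_on (\<lambda>a. {w a, w (a + 1)}) short"
    proof (rule inj_onI)
      fix a b assume ab: "a \<in> short" "b \<in> short" "{w a, w (a + 1)} = {w b, w (b + 1)}"
      then consider "w a = w b" | "w a = w (b + 1)" "w (a + 1) = w b" by (auto simp: doubleton_eq_iff)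
      then show "a = b"
      proof cases
        case 1
        then show ?thesis using inj[of a b] ab(1,2) unfolding short_def by auto
      next
        case 2
        then have "a = b + 1" "a + 1 = b"
          using inj[of a "b + 1"] inj[of "a + 1" b] ab(1,2) unfolding short_def by auto
        then show ?thesis by simp
      qed
    qed
    show "(\<lambda>a. {w a, w (a + 1)}) ` short = {e \<in> F. \<exists>i. e = {w i, w (i + 1)}}"
    proof (intro equalityI subsetI)
      fix e assume "e \<in> (\<lambda>a. {w a, w (a + 1)}) ` short"
      then obtain a where "a \<in> short" "e = {w a, w (a + 1)}" by blast
      then show "e \<in> {e \<in> F. \<exists>i. e = {w i, w (i + 1)}}"
        using edge[of a] unfolding short_def by auto
    next
      fix e assume "e \<in> {e \<in> F. \<exists>i. e = {w i, w (i + 1)}}"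
      then obtain i where e: "e \<in> F" "e = {w i, w (i + 1)}" by blast
      obtain a where a: "j \<le> a" "a \<le> j + 4 * h" "w a = w i" using w_window by metis
      then have "w (a + 1) = w (i + 1)" by (simp add: w_eq_iff)
      then have e': "e = {w a, w (a + 1)}" using e a by simp
      have "a \<noteq> j" using rim_mate[of "a + 1"] e(1) e' by auto
      moreover have "a \<noteq> j + 4 * h"
      proof
        assume "a = j + 4 * h"
        then have "w (a + 1) = w j" using w_shift(1)[of j] by (simp add: add.assoc)
        then show False using rim_mate[of a] e(1) e' by (simp add: insert_commute)
      qed
      ultimately have "a \<in> short" using a mate[of a "a + 1"] e(1) e' unfolding short_def by auto
      then show "e \<in> (\<lambda>a. {w a, w (a + 1)}) ` short" using e' by blast
    qed
  qed
  have finite_short: "finite short"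
    by (rule finite_subset[of _ "{j + 1..j + 4 * h}"]) (auto simp: short_def)
  have w_left: "w (j - u) = w (j + (4 * h + 1 - u))" for u
    using w_shift(1)[of "j - u"] by (simp add: algebra_simps)
  show ?thesis
    unfolding bij_betw_same_card[OF bij, symmetric]
  proof
    assume two: "card short = 2"
    have three: False
      if "j + 1 \<le> a" "a < b" "b < c" "c < j + 4 * h" "\<mu> a = a + 1" "\<mu> b = b + 1" "\<mu> c = c + 1" for a b c
    proof -
      have "{a, b, c} \<subseteq> short" using that unfolding short_def by auto
      then have "card {a, b, c} \<le> 2" using card_mono[OF finite_short] two by metis
      then show False using that by simp
    qed
    have right: "\<mu> a = 2 * j + 2 * h + 1 - a" if "j + 1 \<le> a" "a \<le> j + 2 * h" for a
      by (rule nc_matching_two_short_chords(1)[OF nc\<mu> h_pos _ _ that]) (fact len, fact three)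
    have left: "\<mu> a = 2 * j + 6 * h + 1 - a" if "j + 2 * h + 1 \<le> a" "a \<le> j + 4 * h" for a
      by (rule nc_matching_two_short_chords(2)[OF nc\<mu> h_pos _ _ that]) (fact len, fact three)
    have "{w (j - u), w (j - (2 * h + 1 - u))} \<in> F" if "1 \<le> u" "u \<le> 2 * h" for u
      using edge[of "j + (4 * h + 1 - u)"] left[of "j + (4 * h + 1 - u)"] that
      unfolding w_left by (simp add: algebra_simps)
    moreover have "{w (j + u), w (j + (2 * h + 1 - u))} \<in> F" if "1 \<le> u" "u \<le> 2 * h" for u
      using edge[of "j + u"] right[of "j + u"] that by (simp add: algebra_simps)
    ultimately show "nested_left j \<and> nested_right j"
      unfolding nested_left_def nested_right_def by simp
  next
    assume nested: "nested_left j \<and> nested_right j"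
    have right: "\<mu> a = 2 * j + 2 * h + 1 - a" if a: "j + 1 \<le> a" "a \<le> j + 2 * h" for a
    proof (rule mate)
      have "a - j \<in> {1..2 * h}" using a by auto
      then have "{w (j + (a - j)), w (j + (2 * h + 1 - (a - j)))} \<in> F"
        using nested unfolding nested_right_def by blast
      then show "{w a, w (2 * j + 2 * h + 1 - a)} \<in> F" by (simp add: algebra_simps)
    qed (use a h_pos in auto)
    have left: "\<mu> a = 2 * j + 6 * h + 1 - a" if a: "j + 2 * h + 1 \<le> a" "a \<le> j + 4 * h" for a
    proof (rule mate)
      let ?u = "j + 4 * h + 1 - a"
      have "?u \<in> {1..2 * h}" using a by auto
      then have "{w (j - ?u), w (j - (2 * h + 1 - ?u))} \<in> F"
        using nested unfolding nested_left_def by blast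
      then show "{w a, w (2 * j + 6 * h + 1 - a)} \<in> F"
        unfolding w_left by (simp add: algebra_simps)
    qed (use a h_pos in auto)
    have "short = {j + h, j + 3 * h}"
    proof (intro equalityI subsetI)
      fix a assume "a \<in> short"
      then have a: "j + 1 \<le> a" "a < j + 4 * h" "\<mu> a = a + 1" unfolding short_def by auto
      show "a \<in> {j + h, j + 3 * h}"
        using a right[of a] left[of a] by (cases "a \<le> j + 2 * h") auto
    next
      fix a assume "a \<in> {j + h, j + 3 * h}"
      then show "a \<in> short"
        using right[of "j + h"] left[of "j + 3 * h"] h_pos unfolding short_def by auto
    qed
    then show "card short = 2" using h_pos by simp
  qed
qed

end

section \<open>Edge-disjoint matchings with triangle-free union\<close>

locale wheel_matchings = cyclic_wheel +
  fixes F :: "nat \<Rightarrow> complex set set" and k :: nat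
  assumes k: "int k = h + 1"
    and perfect: "i \<in> {1..k} \<Longrightarrow> perfect_matching S (F i)"
    and nc: "i \<in> {1..k} \<Longrightarrow> noncrossing (F i)"
    and disjoint: "\<lbrakk>i \<in> {1..k}; i' \<in> {1..k}; i \<noteq> i'\<rbrakk> \<Longrightarrow> F i \<inter> F i' = {}"
    and no_triangle: "triangle_free (\<Union>i\<in>{1..k}. F i)"
begin

lemma matching: "i \<in> {1..k} \<Longrightarrow> wheel_matching x S w h (F i)"
  using perfect nc by unfold_locales auto

abbreviation "G \<equiv> \<Union>i\<in>{1..k}. F i"

abbreviation "nested_left i \<equiv> wheel_matching.nested_left w h (F i)"
abbreviation "nested_right i \<equiv> wheel_matching.nested_right w h (F i)"

lemma same_matching: "\<lbrakk>i \<in> {1..k}; i' \<in> {1..k}; e \<in> F i; e \<in> F i'\<rbrakk> \<Longrightarrow> i = i'"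
  using disjoint by blast

lemma triangleD:
  assumes "{p, q} \<in> G" "{q, r} \<in> G" "{p, r} \<in> G"
  shows False
proof -
  have "a \<noteq> b" if "{a, b} \<in> G" for a b
    using that wheel_matching.edge_distinct[OF matching] by blast
  then have "p \<noteq> q" "q \<noteq> r" "p \<noteq> r" using assms by auto
  then show False using assms no_triangle unfolding triangle_free_def by blast
qed

text \<open>Each matching has one radial edge, and different matchings have different ones.\<close>

lemma card_radial_indices:
  "int (card ({a. {x, w a} \<in> G} \<inter> {c..c + 4 * h})) = h + 1"
proof -
  have "\<exists>a. c \<le> a \<and> a \<le> c + 4 * h \<and> {x, w a} \<in> F i" if "i \<in> {1..k}" for i
    using wheel_matching.radial_edge_exists[OF matching[OF that]] w_window by metis
  then obtain f where f: "\<And>i. i \<in> {1..k} \<Longrightarrow> c \<le> f i \<and> f i \<le> c + 4 * h \<and> {x, w (f i)} \<in> F i"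
    by metis
  have "bij_betw f {1..k} ({a. {x, w a} \<in> G} \<inter> {c..c + 4 * h})"
  proof (rule bij_betw_imageI)
    show "inj_on f {1..k}" by (rule inj_onI) (metis f same_matching)
    have "a = f i" if "i \<in> {1..k}" "{x, w a} \<in> F i" "c \<le> a" "a \<le> c + 4 * h" for a i
      using wheel_matching.radial_edge_unique[OF matching[OF that(1)] that(2), of "f i" c] f that
      by auto
    then have "a \<in> f ` {1..k}" if "{x, w a} \<in> G" "c \<le> a" "a \<le> c + 4 * h" for a
      using that by blast
    then have "{a. {x, w a} \<in> G} \<inter> {c..c + 4 * h} \<subseteq> f ` {1..k}"
      by (intro subsetI) (simp only: Int_iff mem_Collect_eq atLeastAtMost_iff)
    moreover have "f ` {1..k} \<subseteq> {a. {x, w a} \<in> G} \<inter> {c..c + 4 * h}"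
    proof (rule image_subsetI)
      fix i assume i: "i \<in> {1..k}"
      then have "{x, w (f i)} \<in> G" using f[OF i] by blast
      then show "f i \<in> {a. {x, w a} \<in> G} \<inter> {c..c + 4 * h}" using f[OF i] by simp
    qed
    ultimately show "f ` {1..k} = {a. {x, w a} \<in> G} \<inter> {c..c + 4 * h}" by blast
  qed
  from bij_betw_same_card[OF this] show ?thesis using k by simp
qed

text \<open>
  If every matching consists of two stacks, the indices of the radial edges satisfy the three
  conditions that force a circular interval. Antipodal radial edges would give two matchings a
  common stack. A wide triple \<open>a\<close>, \<open>b\<close>, \<open>c\<close>, or one that splits a wide pair, gives a triangle on
  the rim: its sides lie in stacks belonging to \<open>a\<close>, \<open>b\<close>, \<open>c\<close>, and as all chords of a stack have
  the same index sum, the three sums determine the corners.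
\<close>

lemma nested_imp_radial_interval:
  assumes nested: "\<And>i j. \<lbrakk>i \<in> {1..k}; {x, w j} \<in> F i\<rbrakk> \<Longrightarrow> nested_left i j \<and> nested_right i j"
  shows "\<exists>c. {a. {x, w a} \<in> G} \<inter> {c..c + 4 * h} = {c..c + h}"
proof (rule circular_interval[OF h_pos])
  let ?J = "{a. {x, w a} \<in> G}"
  have left: "\<exists>i\<in>{1..k}. {x, w j} \<in> F i \<and> {w p, w q} \<in> F i"
    if j: "j \<in> ?J" "j - 2 * h \<le> p" "p < j" "p + q = 2 * j - 2 * h - 1" for j p q
  proof -
    obtain i where i: "i \<in> {1..k}" "{x, w j} \<in> F i" using j by blast
    have "j - p \<in> {1..2 * h}" using j by auto
    then have "{w (j - (j - p)), w (j - (2 * h + 1 - (j - p)))} \<in> F i"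
      using nested[OF i] unfolding wheel_matching.nested_left_def[OF matching[OF i(1)]] by blast
    moreover have "q = j - (2 * h + 1 - (j - p))" using j by linarith
    ultimately show ?thesis using i by auto
  qed
  have right: "\<exists>i\<in>{1..k}. {x, w j} \<in> F i \<and> {w p, w q} \<in> F i"
    if j: "j \<in> ?J" "j < p" "p \<le> j + 2 * h" "p + q = 2 * j + 2 * h + 1" for j p q
  proof -
    obtain i where i: "i \<in> {1..k}" "{x, w j} \<in> F i" using j by blast
    have "p - j \<in> {1..2 * h}" using j by auto
    then have "{w (j + (p - j)), w (j + (2 * h + 1 - (p - j)))} \<in> F i"
      using nested[OF i] unfolding wheel_matching.nested_right_def[OF matching[OF i(1)]] by blast
    moreover have "q = j + (2 * h + 1 - (p - j))" using j by linarith
    ultimately show ?thesis using i by auto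
  qed
  have leftG: "{w p, w q} \<in> G"
    if "j \<in> ?J" "j - 2 * h \<le> p" "p < j" "p + q = 2 * j - 2 * h - 1" for j p q
    using left[OF that] by blast
  have rightG: "{w p, w q} \<in> G"
    if "j \<in> ?J" "j < p" "p \<le> j + 2 * h" "p + q = 2 * j + 2 * h + 1" for j p q
    using right[OF that] by blast
  show per: "a + (4 * h + 1) \<in> ?J \<longleftrightarrow> a \<in> ?J" for a by simp
  show "int (card (?J \<inter> {c..c + 4 * h})) = h + 1" for c by (rule card_radial_indices)
  show anti: "a + 2 * h + 1 \<notin> ?J" if a: "a \<in> ?J" for a
  proof
    assume a': "a + 2 * h + 1 \<in> ?J"
    obtain i where i: "i \<in> {1..k}" "{x, w a} \<in> F i" "{w (a + 1), w (a + 2 * h)} \<in> F i"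
      using right[OF a, of "a + 1" "a + 2 * h"] h_pos by auto
    obtain i' where i': "i' \<in> {1..k}" "{x, w (a + 2 * h + 1)} \<in> F i'"
      "{w (a + 1), w (a + 2 * h)} \<in> F i'"
      using left[OF a', of "a + 1" "a + 2 * h"] h_pos by auto
    have "i = i'" using same_matching i i' by blast
    then have "a = a + 2 * h + 1"
      using wheel_matching.radial_edge_unique[OF matching[OF i(1)], of a "a + 2 * h + 1" a]
        i i' h_pos by auto
    then show False using h_pos by simp
  qed
  show "a + 2 * h \<notin> ?J" if a: "a \<in> ?J" for a
  proof
    assume "a + 2 * h \<in> ?J"
    then have "a + 2 * h + 2 * h + 1 \<notin> ?J" by (rule anti)
    then show False using per[of a] a by (simp add: algebra_simps)
  qed
  show False
    if abc: "a \<in> ?J" "b \<in> ?J" "c \<in> ?J" "b - a \<ge> h + 1" "c - b \<ge> h + 1" "c - a \<le> 3 * h" for a b c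
  proof (rule triangleD[of "w (a + b - c + 3 * h + 1)" "w (a + c - b - h)" "w (b + c - a - h)"])
    show "{w (a + b - c + 3 * h + 1), w (a + c - b - h)} \<in> G"
      by (rule rightG[OF abc(1)]) (use abc h_pos in linarith)+
    show "{w (a + b - c + 3 * h + 1), w (b + c - a - h)} \<in> G"
      by (rule rightG[OF abc(2)]) (use abc h_pos in linarith)+
    have "{w (b + c - a - h), w (a + c - b - h + (4 * h + 1))} \<in> G"
      by (rule rightG[OF abc(3)]) (use abc h_pos in linarith)+
    then show "{w (a + c - b - h), w (b + c - a - h)} \<in> G"
      unfolding w_shift by (simp only: insert_commute)
  qed
  show False
    if abc: "a \<in> ?J" "b \<in> ?J" "c \<in> ?J" "a < c" "c < b" "c - a \<le> h" "b - c \<le> h"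
      "b - a \<ge> h + 1" "b - a \<le> 2 * h - 1" for a b c
  \<comment> \<open>Either \<open>a\<close> and \<open>b\<close> contribute right-hand stacks and \<open>c\<close> a left-hand one, or the other way
    round. The first choice needs \<open>b - c < h\<close>, the second \<open>c - a < h\<close>.\<close>
  proof (cases "b - c \<le> h - 1")
    case True
    show False
    proof (rule triangleD[of "w (a + b - c + h + 1)" "w (a + c - b + h)" "w (b + c - a + h)"])
      show "{w (a + b - c + h + 1), w (a + c - b + h)} \<in> G"
        by (rule rightG[OF abc(1)]) (use abc True in linarith)+
      show "{w (a + b - c + h + 1), w (b + c - a + h)} \<in> G"
        by (rule rightG[OF abc(2)]) (use abc True in linarith)+
      have "{w (a + c - b + h), w (b + c - a + h - (4 * h + 1))} \<in> G"
        by (rule leftG[OF abc(3)]) (use abc True in linarith)+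
      then show "{w (a + c - b + h), w (b + c - a + h)} \<in> G"
        unfolding w_shift .
    qed
  next
    case False
    show False
    proof (rule triangleD[of "w (a + b - c - h - 1)" "w (a + c - b - h)" "w (b + c - a - h)"])
      show "{w (a + b - c - h - 1), w (a + c - b - h)} \<in> G"
        by (rule leftG[OF abc(1)]) (use abc False in linarith)+
      show "{w (a + b - c - h - 1), w (b + c - a - h)} \<in> G"
        by (rule leftG[OF abc(2)]) (use abc False in linarith)+
      have "{w (b + c - a - h), w (a + c - b - h + (4 * h + 1))} \<in> G"
        by (rule rightG[OF abc(3)]) (use abc False in linarith)+
      then show "{w (a + c - b - h), w (b + c - a - h)} \<in> G"
        unfolding w_shift by (simp only: insert_commute)
    qed
  qed
qed

text \<open>
  The induction runs downwards from \<open>j = h\<close>. Left of \<open>w\<^sub>j\<close>, the chords whose indices sum to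
  more than \<open>2j - 2h - 1\<close> are ruled out: positive sums because the indices from \<open>0\<close> to \<open>h\<close> are
  pairwise non-adjacent (they are neighbours of \<open>x\<close>), so that enough negative indices must lie
  under the chord to match the non-negative ones; even sums by parity; and the remaining negative
  sums because those chords belong to the matchings treated before. On the other hand a chord
  at the upper end of the interval still to be matched cannot have a smaller sum: first because
  it has length below \<open>2h\<close>, later because it must stay under the preceding chord.
\<close>

lemma radial_interval_imp_nested_left:
  assumes radial: "\<And>a. 0 \<le> a \<Longrightarrow> a \<le> h \<Longrightarrow> {x, w a} \<in> G"
    and "i \<in> {1..k}" "{x, w j} \<in> F i" "0 \<le> j" "j \<le> h"
  shows "nested_left i j"
  using assms(2-)
proof (induction "nat (h - j)" arbitrary: i j rule: less_induct)
  case less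
  note i = less.prems(1) and ij = less.prems(2) and j = less.prems(3,4)
  interpret Fi: wheel_matching x S w h "F i" by (rule matching[OF i])
  \<comment> \<open>The cut is placed at \<open>j - (4h + 1)\<close>, a second index of \<open>w\<^sub>j\<close>, so that the points to the left
    of \<open>w\<^sub>j\<close> have the indices just below \<open>j\<close>.\<close>
  define o' where "o' = j - (4 * h + 1)"
  have o'_radial: "{x, w o'} \<in> F i" using ij unfolding o'_def w_shift .
  obtain \<mu> where nc\<mu>: "nc_matching (o' + 1) (o' + 4 * h) \<mu>"
    and edge: "\<And>a. \<lbrakk>o' + 1 \<le> a; a \<le> o' + 4 * h\<rbrakk> \<Longrightarrow> {w a, w (\<mu> a)} \<in> F i"
    and len: "\<And>a. \<lbrakk>o' + 1 \<le> a; a \<le> o' + 4 * h\<rbrakk> \<Longrightarrow> \<bar>\<mu> a - a\<bar> \<le> 2 * h"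
    using Fi.linear_matching[OF o'_radial] by blast
  have bounds: "o' + 1 = j - 4 * h" "o' + 4 * h = j - 1" unfolding o'_def by auto
  note nc\<mu> = nc\<mu>[unfolded bounds] and edge = edge[unfolded bounds] and len = len[unfolded bounds]
  note M = nc_matchingD[OF nc\<mu>]
  have independent: False if "0 \<le> a" "a \<le> j - 1" "0 \<le> \<mu> a" for a
  proof (rule triangleD[of x "w a" "w (\<mu> a)"])
    show "{w a, w (\<mu> a)} \<in> G" using edge[of a] that i h_pos j by auto
    show "{x, w a} \<in> G" by (rule radial) (use that j in auto)
    show "{x, w (\<mu> a)} \<in> G" by (rule radial) (use that j M(2)[of a] h_pos in auto)
  qed
  have sum_neg: "a + \<mu> a \<le> -1" if a: "j - 4 * h \<le> a" "a < \<mu> a" "\<mu> a \<le> j - 1" for a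
  proof (cases "\<mu> a < 0")
    case False
    have ar: "a \<le> j - 1" using a by linarith
    have "a < 0"
    proof (rule ccontr)
      assume "\<not> a < 0"
      then show False using a False by (intro independent[of a]) auto
    qed
    have under: "a < \<mu> c \<and> \<mu> c < 0" if c: "0 \<le> c" "c < \<mu> a" for c
    proof -
      have "\<mu> c < 0"
      proof (rule ccontr)
        assume "\<not> \<mu> c < 0"
        then show False using a c by (intro independent[of c]) auto
      qed
      moreover have "a < \<mu> c"
        using nc_matchingD(1)[OF nc_matching_inside_chord[OF nc\<mu> a(1) ar], of c] c \<open>a < 0\<close> by auto
      ultimately show ?thesis by simp
    qed
    have "inj_on \<mu> {0..<\<mu> a}"
    proof (rule inj_onI)
      fix c d assume cd: "c \<in> {0..<\<mu> a}" "d \<in> {0..<\<mu> a}" "\<mu> c = \<mu> d"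
      have "\<mu> (\<mu> c) = c" by (rule M(4)) (use a \<open>a < 0\<close> cd(1) in auto)
      moreover have "\<mu> (\<mu> d) = d" by (rule M(4)) (use a \<open>a < 0\<close> cd(2) in auto)
      ultimately show "c = d" using cd(3) by metis
    qed
    moreover have "\<mu> ` {0..<\<mu> a} \<subseteq> {a + 1..<0}"
    proof (rule image_subsetI)
      fix c assume "c \<in> {0..<\<mu> a}"
      then have "a < \<mu> c \<and> \<mu> c < 0" by (intro under) simp_all
      then show "\<mu> c \<in> {a + 1..<0}" by simp
    qed
    ultimately have "card {0..<\<mu> a} \<le> card {a + 1..<0}"
      by (rule card_inj_on_le) simp
    then show ?thesis using False \<open>a < 0\<close> by simp
  next
    case True
    then show ?thesis using a by linarith
  qed
  have sum_le: "a + \<mu> a \<le> 2 * j - 2 * h - 1" if a: "j - 4 * h \<le> a" "a < \<mu> a" "\<mu> a \<le> j - 1" for a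
  proof (rule ccontr)
    assume large: "\<not> a + \<mu> a \<le> 2 * j - 2 * h - 1"
    have ar: "a \<le> j - 1" using a by linarith
    have "odd (\<mu> a - a)" by (rule nc_matching_chord_odd[OF nc\<mu> a(1) ar])
    then have "odd (a + \<mu> a)" by presburger
    then obtain t where t: "a + \<mu> a = 2 * t + 1" by (elim oddE)
    define j' where "j' = h + t + 1"
    have j': "j < j'" "j' \<le> h" using large sum_neg[OF a] t unfolding j'_def by linarith+
    obtain i' where i': "i' \<in> {1..k}" "{x, w j'} \<in> F i'"
      using radial[of j'] j' j(1) by force
    have "nested_left i' j'"
      by (rule less.hyps) (use i' j' j in auto)
    moreover have "j' - \<mu> a \<in> {1..2 * h}"
    proof -
      have "1 \<le> j' - \<mu> a" "j' - \<mu> a \<le> 2 * h"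
        using a j' j t large unfolding j'_def by linarith+
      then show ?thesis by simp
    qed
    ultimately have "{w (j' - (j' - \<mu> a)), w (j' - (2 * h + 1 - (j' - \<mu> a)))} \<in> F i'"
      unfolding wheel_matching.nested_left_def[OF matching[OF i'(1)]] by blast
    moreover have "j' - (j' - \<mu> a) = \<mu> a" "j' - (2 * h + 1 - (j' - \<mu> a)) = a"
      using t unfolding j'_def by linarith+
    ultimately have "{w (\<mu> a), w a} \<in> F i'" by (simp only:)
    then have "{w a, w (\<mu> a)} \<in> F i'" by (simp only: insert_commute)
    then have "i = i'" using same_matching[OF i i'(1)] edge[OF a(1) ar] by blast
    then have "j = j'"
      by (intro Fi.radial_edge_unique[of j j' 0]) (use ij i'(2) j j' h_pos in simp_all)
    then show False using j' by simp
  qed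
  have stack: "\<mu> (j - int u) = j - (2 * h + 1 - int u)" if "1 \<le> u" "int u \<le> h" for u
    using that
  proof (induction u rule: nat_induct_at_least)
    case base
    have r: "j - 4 * h \<le> j - 1" "j - 1 \<le> j - 1" using h_pos by auto
    have m: "\<mu> (j - 1) < j - 1" "j - 4 * h \<le> \<mu> (j - 1)" using M(1-3)[OF r] by linarith+
    have "\<mu> (j - 1) + (j - 1) \<le> 2 * j - 2 * h - 1"
      using sum_le[of "\<mu> (j - 1)", unfolded M(4)[OF r], OF m(2,1) r(2)] .
    moreover have "(j - 1) - \<mu> (j - 1) \<le> 2 * h - 1"
      using len[OF r] nc_matching_chord_odd[OF nc\<mu> r] m by presburger
    ultimately show ?case by simp
  next
    case (Suc u)
    let ?b = "j - int (Suc u)"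
    let ?l = "j - (2 * h + 1 - int u)"
    have IH: "\<mu> (j - int u) = ?l" using Suc by simp
    have l: "j - 4 * h \<le> ?l" "?l \<le> j - 1" using Suc.prems Suc.hyps h_pos by auto
    have r: "j - 4 * h \<le> ?b" "?b \<le> j - 1" using Suc.prems h_pos by auto
    have "\<mu> (\<mu> (j - int u)) = j - int u"
      by (rule M(4)) (use Suc.prems Suc.hyps h_pos in linarith)+
    then have "\<mu> ?l = j - int u" unfolding IH .
    then have inside: "nc_matching (?l + 1) (j - int u - 1) \<mu>"
      using nc_matching_inside_chord[OF nc\<mu> l] by simp
    have m: "?l + 1 \<le> \<mu> ?b" "\<mu> ?b \<le> ?b"
      using nc_matchingD(1,2)[OF inside, of ?b] Suc.prems Suc.hyps by linarith+
    have "\<mu> ?b < ?b" "j - 4 * h \<le> \<mu> ?b" using m M(1-3)[OF r] by linarith+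
    then have "\<mu> ?b + ?b \<le> 2 * j - 2 * h - 1"
      using sum_le[of "\<mu> ?b", unfolded M(4)[OF r]] r(2) by blast
    then show ?case using m by simp
  qed
  have lower_half: "{w (j - u), w (j - (2 * h + 1 - u))} \<in> F i" if "1 \<le> u" "u \<le> h" for u
  proof -
    have "\<mu> (j - u) = j - (2 * h + 1 - u)" using stack[of "nat u"] that by simp
    moreover have "{w (j - u), w (\<mu> (j - u))} \<in> F i" by (rule edge) (use that h_pos in auto)
    ultimately show ?thesis by simp
  qed
  have all: "{w (j - u), w (j - (2 * h + 1 - u))} \<in> F i" if "1 \<le> u" "u \<le> 2 * h" for u
  proof (cases "u \<le> h")
    case False
    have "{w (j - (2 * h + 1 - u)), w (j - (2 * h + 1 - (2 * h + 1 - u)))} \<in> F i"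
      by (rule lower_half) (use that False in linarith)+
    moreover have "2 * h + 1 - (2 * h + 1 - u) = u" by simp
    ultimately show ?thesis by (simp only: insert_commute)
  next
    case True
    then show ?thesis using lower_half[OF that(1) True] by simp
  qed
  show ?case unfolding Fi.nested_left_def
  proof
    fix u assume "u \<in> {1..2 * h}"
    then show "{w (j - u), w (j - (2 * h + 1 - u))} \<in> F i" by (intro all) simp_all
  qed
qed

end

lemma wheel_matchings_dihedral:
  assumes "wheel_matchings x S w h F k" and "\<bar>s\<bar> = 1"
  shows "wheel_matchings x S (\<lambda>a. w (c + s * a)) h F k"
proof -
  interpret wheel_matchings x S w h F k by fact
  interpret dihedral: cyclic_wheel x S "\<lambda>a. w (c + s * a)" h
    using cyclic_wheel_axioms assms(2) by (rule cyclic_wheel_dihedral)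
  show ?thesis
    using k perfect nc disjoint no_triangle by unfold_locales auto
qed

text \<open>The right-hand stacks are the left-hand stacks of the wheel reflected by \<open>a \<mapsto> h - a\<close>.\<close>

lemma (in wheel_matchings) radial_interval_imp_nested:
  assumes radial: "\<And>a. 0 \<le> a \<Longrightarrow> a \<le> h \<Longrightarrow> {x, w a} \<in> G"
    and i: "i \<in> {1..k}" "{x, w j} \<in> F i" "0 \<le> j" "j \<le> h"
  shows "nested_left i j \<and> nested_right i j"
proof
  show "nested_left i j" using radial i by (rule radial_interval_imp_nested_left)
  interpret refl: wheel_matchings x S "\<lambda>a. w (h + - 1 * a)" h F k
    by (rule wheel_matchings_dihedral) (auto intro: wheel_matchings_axioms)
  have "refl.nested_left i (h - j)"
    by (rule refl.radial_interval_imp_nested_left) (use radial i in auto)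
  then show "nested_right i j"
    unfolding wheel_matching.nested_left_def[OF refl.matching[OF i(1)]]
      wheel_matching.nested_right_def[OF matching[OF i(1)]]
    by (simp add: algebra_simps)
qed

section \<open>The characterisation\<close>

lemma (in cyclic_wheel) neighbour_pairs_dihedral:
  assumes "\<bar>s\<bar> = 1"
  shows "(\<exists>i. e = {w (c + s * i), w (c + s * (i + 1))}) \<longleftrightarrow> (\<exists>i. e = {w i, w (i + 1)})"
proof -
  consider "s = 1" | "s = -1" using assms by linarith
  then show ?thesis
  proof cases
    case 1
    have "e = {w i, w (i + 1)} \<longleftrightarrow> e = {w (c + s * (i - c)), w (c + s * ((i - c) + 1))}" for i
      by (simp add: 1 algebra_simps)
    moreover have "e = {w (c + s * i), w (c + s * (i + 1))} \<longleftrightarrow> e = {w (c + i), w ((c + i) + 1)}" for i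
      by (simp add: 1 algebra_simps)
    ultimately show ?thesis by metis
  next
    case 2
    have "e = {w i, w (i + 1)} \<longleftrightarrow> e = {w (c + s * (c - i - 1)), w (c + s * ((c - i - 1) + 1))}" for i
      by (simp add: 2 algebra_simps insert_commute)
    moreover have "e = {w (c + s * i), w (c + s * (i + 1))} \<longleftrightarrow> e = {w (c - i - 1), w ((c - i - 1) + 1)}" for i
      by (simp add: 2 algebra_simps insert_commute)
    ultimately show ?thesis by metis
  qed
qed

theorem theorem3:
  fixes x :: complex and S :: "complex set" and n k :: nat
    and F :: "nat \<Rightarrow> complex set set" and G :: "complex set set"
  assumes "n \<ge> 3" and "odd n"
    and "card S = 2 * n" and "regular_wheel x S"
    and "int k = \<lceil>real n / 2\<rceil>"
    and "\<And>i. i \<in> {1..k} \<Longrightarrow> perfect_matching S (F i)"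
    and "\<And>i. i \<in> {1..k} \<Longrightarrow> noncrossing (F i)"
    and "\<And>i j. i \<in> {1..k} \<Longrightarrow> j \<in> {1..k} \<Longrightarrow> i \<noteq> j \<Longrightarrow> F i \<inter> F j = {}"
    and "G = (\<Union>i\<in>{1..k}. F i)"
    and "geometric_graph S G" and "triangle_free G"
  shows "(\<forall>i\<in>{1..k}. card {e \<in> F i. boundary_edge x S e} = 2) \<longleftrightarrow>
         radial_edges_consecutive x S G k"
proof -
  obtain m where m: "n = 2 * m + 1" using \<open>odd n\<close> by (elim oddE)
  define h where "h = int m"
  have h: "h \<ge> 1" "int n = 2 * h + 1" using m \<open>n \<ge> 3\<close> unfolding h_def by auto
  have k: "int k = h + 1"
  proof -
    have "\<lceil>real n / 2\<rceil> = h + 1" unfolding m h_def by (rule ceiling_unique) auto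
    then show ?thesis using assms(5) by simp
  qed
  have cardS: "int (card S) = 4 * h + 2" using assms(3) h by simp
  define N where "N = card S - 1"
  have N: "int N = 4 * h + 1" using cardS h unfolding N_def by linarith
  obtain w where "cyclic_wheel x S w h"
    and labelling: "\<And>v. wheel_labelling x S v \<longleftrightarrow>
           (\<exists>c s. \<bar>s\<bar> = 1 \<and> (\<forall>j<N. v j = w (c + s * int j)))"
    using regular_wheel_obtain_labelling[OF assms(4) cardS h(1)] unfolding N_def by blast
  interpret W: cyclic_wheel x S w h by fact
  interpret M: wheel_matchings x S w h F k
    using k assms(6-8,11) unfolding assms(9) by unfold_locales auto
  have boundary: "boundary_edge x S e \<longleftrightarrow> (\<exists>i. e = {w i, w (i + 1)})" for e
  proof
    assume "boundary_edge x S e"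
    then obtain v i c s where s: "\<bar>s\<bar> = 1" and v: "\<And>j. j < N \<Longrightarrow> v j = w (c + s * int j)"
      and i: "i < N" "e = {v i, v (Suc i mod N)}"
      unfolding boundary_edge_def N_def[symmetric] labelling by blast
    have "w (c + s * int (Suc i mod N)) = w (c + s * (int i + 1))"
    proof (cases "Suc i = N")
      case True
      then have "int i + 1 = 4 * h + 1" using N by linarith
      then have "w (c + s * (int i + 1)) = w c"
        using N s by (auto simp: W.w_eq_iff)
      then show ?thesis using True by simp
    next
      case False
      then show ?thesis using i(1) by (simp add: add.commute)
    qed
    then have "e = {w (c + s * int i), w (c + s * (int i + 1))}"
      using i v[of i] v[of "Suc i mod N"] by simp
    then show "\<exists>i. e = {w i, w (i + 1)}" using W.neighbour_pairs_dihedral[OF s] by blast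
  next
    assume "\<exists>i. e = {w i, w (i + 1)}"
    then obtain i where e: "e = {w i, w (i + 1)}" by blast
    let ?v = "\<lambda>j. w (i + 1 * int j)"
    have "wheel_labelling x S ?v" unfolding labelling by (intro exI[of _ i] exI[of _ 1]) auto
    moreover have "e = {?v 0, ?v (Suc 0 mod N)}" "0 < N" using e N h by auto
    ultimately show "boundary_edge x S e"
      unfolding boundary_edge_def N_def[symmetric] by blast
  qed
  have radial_edges: "{e \<in> G. radial_edge x S e} = {{x, w a} | a. {x, w a} \<in> G}"
    unfolding radial_edge_def using W.points W.w_neq_x by auto
  show ?thesis
  proof
    assume two: "\<forall>i\<in>{1..k}. card {e \<in> F i. boundary_edge x S e} = 2"
    have "M.nested_left i j \<and> M.nested_right i j" if "i \<in> {1..k}" "{x, w j} \<in> F i" for i j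
      using two wheel_matching.two_boundary_edges_iff_nested[OF M.matching that(2)] that
      unfolding boundary by blast
    then obtain c where c: "{a. {x, w a} \<in> G} \<inter> {c..c + 4 * h} = {c..c + h}"
      using M.nested_imp_radial_interval assms(9) by auto
    let ?v = "\<lambda>j. w (c + 1 * int j)"
    have "wheel_labelling x S ?v" unfolding labelling by (intro exI[of _ c] exI[of _ 1]) auto
    moreover have "{{x, w a} | a. {x, w a} \<in> G} = {{x, ?v j} | j. j < k}"
    proof (intro equalityI subsetI)
      fix e assume "e \<in> {{x, w a} | a. {x, w a} \<in> G}"
      then obtain a where a: "e = {x, w a}" "{x, w a} \<in> G" by blast
      obtain b where b: "c \<le> b" "b \<le> c + 4 * h" "w b = w a" using W.w_window by blast
      then have "b \<in> {c..c + h}" using a c by auto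
      then have "e = {x, ?v (nat (b - c))}" "nat (b - c) < k" using a b k by auto
      then show "e \<in> {{x, ?v j} | j. j < k}" by blast
    next
      fix e assume "e \<in> {{x, ?v j} | j. j < k}"
      then obtain j where j: "e = {x, ?v j}" "j < k" by blast
      then have "c + int j \<in> {c..c + h}" using k by auto
      then show "e \<in> {{x, w a} | a. {x, w a} \<in> G}" using c j by auto
    qed
    ultimately show "radial_edges_consecutive x S G k"
      unfolding radial_edges_consecutive_def radial_edges by blast
  next
    assume "radial_edges_consecutive x S G k"
    then obtain v c s where s: "\<bar>s\<bar> = 1" and v: "\<And>j. j < N \<Longrightarrow> v j = w (c + s * int j)"
      and radial: "{{x, w a} | a. {x, w a} \<in> G} = {{x, v j} | j. j < k}"
      unfolding radial_edges_consecutive_def labelling radial_edges by blast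
    define u where "u a = w (c + s * a)" for a
    interpret U: wheel_matchings x S u h F k
      unfolding u_def by (rule wheel_matchings_dihedral[OF M.wheel_matchings_axioms s])
    have "k \<le> N" using k N h by linarith
    then have radial_u: "{{x, w a} | a. {x, w a} \<in> G} = {{x, u (int j)} | j. j < k}"
      unfolding radial u_def using v by (metis (no_types, lifting) order_less_le_trans)
    have radial_in: "{x, u a} \<in> G" if "0 \<le> a" "a \<le> h" for a
    proof -
      have "{x, u (int (nat a))} \<in> {{x, w a} | a. {x, w a} \<in> G}"
        unfolding radial_u using that k by (intro CollectI exI[of _ "nat a"]) auto
      then show ?thesis using that by auto
    qed
    show "\<forall>i\<in>{1..k}. card {e \<in> F i. boundary_edge x S e} = 2"
    proof
      fix i assume i: "i \<in> {1..k}"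
      interpret Fi: wheel_matching x S u h "F i" by (rule U.matching[OF i])
      obtain a where a: "{x, u a} \<in> F i" using Fi.radial_edge_exists by blast
      then have "{x, w (c + s * a)} \<in> G" using i assms(9) unfolding u_def by blast
      then have "{x, u a} \<in> {{x, w a} | a. {x, w a} \<in> G}" unfolding u_def by blast
      then obtain j where j: "{x, u a} = {x, u (int j)}" "j < k" unfolding radial_u by blast
      have rad: "{x, u (int j)} \<in> F i" using a j by simp
      have "U.nested_left i (int j) \<and> U.nested_right i (int j)"
        by (rule U.radial_interval_imp_nested) (use radial_in assms(9) i rad j k in auto)
      then have "card {e \<in> F i. \<exists>i. e = {u i, u (i + 1)}} = 2"
        using Fi.two_boundary_edges_iff_nested[OF rad] by blast
      then show "card {e \<in> F i. boundary_edge x S e} = 2"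
        unfolding boundary u_def W.neighbour_pairs_dihedral[OF s] .
    qed
  qed
qed

end
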